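(* Let $d\in\{3,4,5,6,7\}$. Then $$\lim_{q\to\infty}\mathbf{T}_{d,q}=\mathbf{T}_{d,\infty}=\left(\frac{2\pi^{d/2}}{\Gamma(\frac d2)}\right)^{1/2}.$$
   Context: For $d\geq 2$, $\sigma_{d-1}$ denotes the usual surface measure on the unit sphere $\mathbb{S}^{d-1}\subset\mathbb{R}^d$, and $L^2(\mathbb{S}^{d-1})$ is the space of complex-valued functions square-integrable with respect to $\sigma_{d-1}$. The extension operator is $\widehat{f\sigma}_{d-1}(x)=\int_{\mathbb{S}^{d-1}} f(\omega)e^{-ix\cdot\omega}\,d\sigma_{d-1}(\omega)$, $x\in\mathbb{R}^d$. For $q\in[2\frac{d+1}{d-1},\infty]$, $\mathbf{T}_{d,q}$ denotes the optimal (smallest) constant in the inequality $\|\widehat{f\sigma}_{d-1}\|_{L^q(\mathbb{R}^d)}\leq \mathbf{T}_{d,q}\|f\|_{L^2(\mathbb{S}^{d-1})}$ for all $f\in L^2(\mathbb{S}^{d-1})$, i.e. $\mathbf{T}_{d,q}=\sup_{0\neq f\in L^2}\|\widehat{f\sigma}_{d-1}\|_{L^q(\mathbb{R}^d)}/\|f\|_{L^2(\mathbb{S}^{d-1})}$. The limit is over real $q\to\infty$. *)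

theory Defs
  imports "HOL-Probability.Essential_Supremum"
begin

text \<open>
  Surface measure on the unit sphere, in the polar-coordinates normalisation
  \<open>\<sigma>(A) = d * vol {r \<omega> | 0 < r < 1, \<omega> \<in> A}\<close> for Borel sets \<open>A\<close> of the sphere, so that
  Lebesgue measure is \<open>r ^ (d - 1) dr d\<sigma>(\<omega>)\<close> in polar coordinates.
\<close>

definition sphere_measure :: "'a::euclidean_space measure" where
  "sphere_measure =
     scale_measure (of_nat DIM('a))
       (distr (restrict_space lborel (ball 0 1 - {0}))
              (restrict_space borel (sphere 0 1))
              (\<lambda>x. x /\<^sub>R norm x))"

text \<open>
  The \<open>L\<^sup>q\<close> norm for \<open>0 < q \<le> \<infinity>\<close>, with value \<open>\<infinity>\<close> when the function is not in \<open>L\<^sup>q\<close>. The case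
  distinction on the value of the integral is needed because \<open>enn2real \<infinity> = 0\<close>.
\<close>

definition Lq_norm :: "'a measure \<Rightarrow> ennreal \<Rightarrow> ('a \<Rightarrow> complex) \<Rightarrow> ennreal" where
  "Lq_norm M q f =
     (if q = \<infinity> then esssup M (\<lambda>x. ennreal (norm (f x)))
      else let I = (\<integral>\<^sup>+x. ennreal (norm (f x) powr enn2real q) \<partial>M)
           in if I = \<infinity> then \<infinity> else ennreal (enn2real I powr (1 / enn2real q)))"

definition L2_sphere :: "('a::euclidean_space \<Rightarrow> complex) set" where
  "L2_sphere = {f \<in> borel_measurable sphere_measure. Lq_norm sphere_measure 2 f < \<infinity>}"

definition extension :: "('a::euclidean_space \<Rightarrow> complex) \<Rightarrow> 'a \<Rightarrow> complex" where
  "extension f x = (LINT \<omega>|sphere_measure. f \<omega> * exp (- (\<i> * complex_of_real (x \<bullet> \<omega>))))"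

text \<open>
  The optimal constant; the ambient space \<open>'a\<close> of dimension \<open>d\<close> is passed as a type argument.
  It is the constant of the Tomas--Stein inequality when \<open>2 (d + 1) / (d - 1) \<le> q \<le> \<infinity>\<close>, but the
  supremum makes sense in \<open>[0, \<infinity>]\<close> for every \<open>q\<close>.
\<close>

definition extension_const :: "'a::euclidean_space itself \<Rightarrow> ennreal \<Rightarrow> ennreal" where
  "extension_const _ q =
     (SUP f \<in> {f :: 'a \<Rightarrow> complex. f \<in> L2_sphere \<and> \<not> (AE \<omega> in sphere_measure. f \<omega> = 0)}.
        Lq_norm lborel q (extension f) / Lq_norm sphere_measure 2 f)"

end

theory Submission
  imports Defs
begin

text \<open>
  Write \<open>A\<close> for the area of the sphere, \<open>h\<close> for the extension of \<open>f\<close> and \<open>F\<close> for its \<open>L\<^sup>2\<close> norm.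

  For \<open>q = \<infinity>\<close>, Cauchy--Schwarz gives \<open>\<bar>h\<bar> \<le> \<surd>A F\<close> (lemma \<open>norm_extension_le\<close>), and \<open>f = 1\<close> attains
  this at the origin. Hence the constant is \<open>\<surd>A\<close>, and \<open>A\<close> is \<open>d\<close> times the volume of the unit ball.

  For the lower bound at finite \<open>q\<close>, the extension of \<open>1\<close> is at least \<open>A (1 - r)\<close> on the ball of
  radius \<open>r\<close> (lemma \<open>norm_sphere_fourier_ge\<close>). The \<open>1/q\<close>-th power of the volume of that ball tends
  to \<open>1\<close>, so the lower limit is at least \<open>\<surd>A (1 - r)\<close> for every \<open>r\<close>.

  For the upper bound, interpolation with the trivial bound \<open>\<surd>A\<close> at \<open>q = \<infinity>\<close> reduces everything to
  one estimate at one finite exponent, however large. Any power decay of the Fourier transform of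
  \<open>\<sigma>\<close> gives such an estimate.

  \<^item> Decay (\<open>sphere_fourier_decay\<close>): \<open>\<sigma>\<close> is \<open>d\<close> times the radial projection of Lebesgue measure on
    the ball, so its transform at \<open>x = R u\<close> is \<open>d\<close> times the integral of
    \<open>exp (- i x \<bullet> y / \<bar>y\<bar>)\<close> over the ball. Averaging over translates along \<open>u\<close> turns it into
    integrals over segments parallel to \<open>u\<close>. On a segment at distance \<open>b\<close> from the line through
    \<open>u\<close>, one integration by parts gives \<open>O(1 / (R b\<^sup>2))\<close>; the segments with \<open>b < \<delta>\<close> fill a
    set of volume \<open>O(\<delta>)\<close>. With \<open>\<delta> = R powr (- 1/3)\<close> this is decay of order \<open>1/3\<close>.

  \<^item> Weak type (\<open>extension_weak_type\<close>): for a set \<open>E\<close> on which \<open>\<bar>h\<bar> \<ge> \<tau>\<close>, testing \<open>h\<close> against its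
    conjugate phase on \<open>E\<close> and applying the \<open>T T\<^sup>*\<close> argument (\<open>integral_norm_fourier_sq_le\<close>) bounds
    \<open>(\<tau> \<bar>E\<bar>)\<^sup>2\<close> by \<open>F\<^sup>2\<close> times the double integral over \<open>E\<close> of the absolute transform of \<open>\<sigma>\<close> at the
    difference of the two points. Decay then gives \<open>\<bar>E\<bar> = O((F/\<tau>) ^ (6 d + 2))\<close>.

  \<^item> Interpolation (\<open>nn_integral_powr_le_of_weak_type\<close>): a dyadic decomposition of \<open>\<bar>h\<bar> / (\<surd>A F)\<close>, a
    function with values in \<open>[0, 1]\<close>, shows that its \<open>q\<close>-th powers have integrals bounded by a number
    \<open>K\<close> independent of \<open>f\<close> and of \<open>q \<ge> 6 d + 3\<close>. So the optimal constant is at most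
    \<open>\<surd>A K powr (1/q)\<close>, which tends to \<open>\<surd>A\<close>.
\<close>

section \<open>The surface measure\<close>

abbreviation phase :: "real \<Rightarrow> complex" where
  "phase t \<equiv> exp (- (\<i> * complex_of_real t))"

abbreviation sphere_fourier :: "'a::euclidean_space \<Rightarrow> complex" where
  "sphere_fourier \<equiv> extension (\<lambda>_. 1)"

definition sphere_area :: "'a::euclidean_space itself \<Rightarrow> real" where
  "sphere_area _ = real DIM('a) * unit_ball_vol (real DIM('a))"

lemma space_sphere_measure: "space (sphere_measure :: 'a::euclidean_space measure) = sphere 0 1"
  by (simp add: sphere_measure_def space_scale_measure space_restrict_space)

lemma sets_sphere_measure [measurable_cong]:
  "sets (sphere_measure :: 'a::euclidean_space measure) = sets (restrict_space borel (sphere 0 1))"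
  by (simp add: sphere_measure_def)

lemma measurable_sphere_measure:
  "f \<in> borel_measurable borel \<Longrightarrow> f \<in> borel_measurable (sphere_measure :: 'a::euclidean_space measure)"
  by (metis measurable_cong_sets measurable_restrict_space1 sets_sphere_measure)

lemma measurable_normalize:
  "(\<lambda>x::'a::euclidean_space. x /\<^sub>R norm x) \<in>
     measurable (restrict_space lborel (ball 0 1 - {0})) (restrict_space borel (sphere 0 1))"
proof (rule measurable_restrict_space2)
  show "(\<lambda>x::'a. x /\<^sub>R norm x) \<in> space (restrict_space lborel (ball 0 1 - {0})) \<rightarrow> sphere 0 1"
    by (auto simp: space_restrict_space)
  show "(\<lambda>x::'a. x /\<^sub>R norm x) \<in> borel_measurable (restrict_space lborel (ball 0 1 - {0}))"
    by (rule measurable_restrict_space1) simp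
qed

lemma sphere_area_pos: "sphere_area TYPE('a::euclidean_space) > 0"
  by (simp add: sphere_area_def)

lemma emeasure_sphere:
  "emeasure sphere_measure (sphere (0::'a::euclidean_space) 1) = ennreal (sphere_area TYPE('a))"
proof -
  let ?B = "restrict_space lborel (ball 0 1 - {0::'a})"
  have "emeasure (distr ?B (restrict_space borel (sphere 0 1)) (\<lambda>x. x /\<^sub>R norm x)) (sphere 0 1)
      = emeasure ?B ((\<lambda>x. x /\<^sub>R norm x) -` sphere 0 1 \<inter> space ?B)"
    by (intro emeasure_distr measurable_normalize) (auto simp: sets_restrict_space_iff)
  also have "(\<lambda>x. x /\<^sub>R norm x) -` sphere 0 1 \<inter> space ?B = ball 0 1 - {0}"
    by (auto simp: space_restrict_space)
  also have "emeasure ?B (ball 0 1 - {0}) = emeasure lborel (ball 0 1 - {0::'a})"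
    by (intro emeasure_restrict_space) auto
  also have "\<dots> = emeasure lborel (ball (0::'a) 1)"
    by (simp add: emeasure_Diff)
  also have "\<dots> = ennreal (unit_ball_vol (real DIM('a)))"
    by (simp add: emeasure_ball)
  finally show ?thesis
    unfolding sphere_measure_def sphere_area_def
    by (simp add: ennreal_mult' ennreal_of_nat_eq_real_of_nat)
qed

interpretation sphere: finite_measure "sphere_measure :: 'a::euclidean_space measure"
  by standard (simp add: space_sphere_measure emeasure_sphere)

lemma measure_sphere:
  "measure sphere_measure (sphere (0::'a::euclidean_space) 1) = sphere_area TYPE('a)"
  using emeasure_sphere[where 'a='a] sphere_area_pos[where 'a='a]
  by (simp add: measure_def)

lemma measurable_phase [measurable]:
  "(\<lambda>p. phase (fst p \<bullet> snd p)) \<in>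
     borel_measurable (lborel \<Otimes>\<^sub>M (sphere_measure :: 'a::euclidean_space measure))"
proof -
  have [measurable]: "snd \<in> measurable (lborel \<Otimes>\<^sub>M (sphere_measure :: 'a measure)) (borel :: 'a measure)"
    using measurable_compose[OF measurable_snd measurable_sphere_measure[of "\<lambda>x. x"]] by simp
  show ?thesis by measurable
qed

lemma norm_phase [simp]: "norm (phase t) = 1"
  using norm_exp_i_times[of "- t"] by simp

text \<open>
  This is where the definition of the surface measure by cones enters: an oscillatory integral over
  the sphere becomes one over the solid ball, where Lebesgue measure can be translated.
\<close>

lemma integral_sphere_measure:
  fixes f :: "'a::euclidean_space \<Rightarrow> complex"
  assumes "f \<in> borel_measurable borel"
  shows "integral\<^sup>L sphere_measure f =
    real DIM('a) *\<^sub>R (LINT y|lborel. indicator (ball 0 1 - {0}) y *\<^sub>R f (y /\<^sub>R norm y))"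
proof -
  let ?N = "restrict_space borel (sphere (0::'a) 1)"
  let ?B = "restrict_space lborel (ball 0 1 - {0::'a})"
  let ?D = "distr ?B ?N (\<lambda>x. x /\<^sub>R norm x)"
  have f: "f \<in> borel_measurable ?N"
    using assms by (rule measurable_restrict_space1)
  have eq: "(sphere_measure :: 'a measure) = density ?D (\<lambda>_. ennreal (real DIM('a)))"
    unfolding sphere_measure_def
    by (rule measure_eqI)
       (auto simp: emeasure_density nn_integral_cmult_indicator ennreal_of_nat_eq_real_of_nat)
  have "integral\<^sup>L sphere_measure f = integral\<^sup>L ?D (\<lambda>x. real DIM('a) *\<^sub>R f x)"
    unfolding eq using f by (intro integral_density) auto
  also have "\<dots> = real DIM('a) *\<^sub>R integral\<^sup>L ?D f"
    by simp
  also have "integral\<^sup>L ?D f = integral\<^sup>L ?B (\<lambda>y. f (y /\<^sub>R norm y))"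
    by (intro integral_distr measurable_normalize f)
  also have "\<dots> = (LINT y|lborel. indicator (ball 0 1 - {0}) y *\<^sub>R f (y /\<^sub>R norm y))"
    by (intro integral_restrict_space) auto
  finally show ?thesis .
qed

section \<open>Averaging over translations\<close>

lemma nn_integral_translate:
  fixes f :: "'a::euclidean_space \<Rightarrow> ennreal"
  assumes [measurable]: "f \<in> borel_measurable borel"
  shows "(\<integral>\<^sup>+y. f (y + c) \<partial>lborel) = (\<integral>\<^sup>+y. f y \<partial>lborel)"
  by (subst (2) lborel_distr_plus[of c, symmetric]) (simp add: nn_integral_distr add.commute)

lemma integral_translate:
  fixes f :: "'a::euclidean_space \<Rightarrow> complex"
  assumes [measurable]: "f \<in> borel_measurable borel"
  shows "(LINT y|lborel. f (y + c)) = (LINT y|lborel. f y)"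
  by (subst (2) lborel_distr_plus[of c, symmetric]) (simp add: integral_distr add.commute)

text \<open>
  Averaging over a segment of translates replaces an iterated integral in adapted coordinates: it
  gives access to one-dimensional integrals in any direction \<open>v\<close>, without a rotation or a splitting
  of the space into a line and its complement.
\<close>

lemma nn_integral_average_translates:
  fixes f :: "'a::euclidean_space \<Rightarrow> ennreal" and v :: 'a
  assumes [measurable]: "f \<in> borel_measurable borel"
  shows "(\<integral>\<^sup>+y. f y \<partial>lborel) =
    (\<integral>\<^sup>+y. (\<integral>\<^sup>+t. f (y + t *\<^sub>R v) * indicator {0..1::real} t \<partial>lborel) \<partial>lborel)"
proof -
  have "(\<integral>\<^sup>+y. (\<integral>\<^sup>+t. f (y + t *\<^sub>R v) * indicator {0..1::real} t \<partial>lborel) \<partial>lborel)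
      = (\<integral>\<^sup>+t. (\<integral>\<^sup>+y. f (y + t *\<^sub>R v) * indicator {0..1::real} t \<partial>lborel) \<partial>lborel)"
    by (rule lborel_pair.Fubini'[symmetric]) measurable
  also have "\<dots> = (\<integral>\<^sup>+t. (\<integral>\<^sup>+y. f y \<partial>lborel) * indicator {0..1::real} t \<partial>lborel)"
    by (simp add: nn_integral_multc nn_integral_translate)
  also have "\<dots> = (\<integral>\<^sup>+y. f y \<partial>lborel)"
    by (simp add: nn_integral_cmult_indicator)
  finally show ?thesis by simp
qed

lemma integral_average_translates:
  fixes f :: "'a::euclidean_space \<Rightarrow> complex" and v :: 'a
  assumes f: "integrable lborel f"
  shows "integrable lborel (\<lambda>y. LINT t|lborel. indicator {0..1::real} t *\<^sub>R f (y + t *\<^sub>R v))"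
    and "(LINT y|lborel. f y) =
      (LINT y|lborel. LINT t|lborel. indicator {0..1::real} t *\<^sub>R f (y + t *\<^sub>R v))"
proof -
  let ?g = "\<lambda>y t. indicator {0..1::real} t *\<^sub>R f (y + t *\<^sub>R v)"
  have [measurable]: "f \<in> borel_measurable borel"
    using f by simp
  have [measurable]: "case_prod ?g \<in> borel_measurable (lborel \<Otimes>\<^sub>M lborel)"
    by measurable
  have g: "integrable (lborel \<Otimes>\<^sub>M lborel) (case_prod ?g)"
  proof (rule integrableI_bounded)
    have "(\<integral>\<^sup>+p. ennreal (norm (case_prod ?g p)) \<partial>(lborel \<Otimes>\<^sub>M lborel))
        = (\<integral>\<^sup>+y. \<integral>\<^sup>+t. ennreal (norm (?g y t)) \<partial>lborel \<partial>lborel)"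
      by (subst lborel.nn_integral_fst[symmetric]) auto
    also have "\<dots> = (\<integral>\<^sup>+y. \<integral>\<^sup>+t. ennreal (norm (f (y + t *\<^sub>R v))) * indicator {0..1} t \<partial>lborel \<partial>lborel)"
      by (intro nn_integral_cong) (auto split: split_indicator)
    also have "\<dots> = (\<integral>\<^sup>+y. ennreal (norm (f y)) \<partial>lborel)"
      by (rule nn_integral_average_translates[symmetric]) measurable
    also have "\<dots> < \<infinity>"
      using f by (simp add: integrable_iff_bounded)
    finally show "(\<integral>\<^sup>+p. ennreal (norm (case_prod ?g p)) \<partial>(lborel \<Otimes>\<^sub>M lborel)) < \<infinity>" .
  qed measurable
  show "integrable lborel (\<lambda>y. LINT t|lborel. ?g y t)"
    by (rule lborel_pair.integrable_fst[OF g])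
  have "(LINT y|lborel. LINT t|lborel. ?g y t) = (LINT t|lborel. LINT y|lborel. ?g y t)"
    by (rule lborel_pair.Fubini_integral[OF g, symmetric])
  also have "\<dots> = (LINT t|lborel. indicator {0..1::real} t *\<^sub>R (LINT y|lborel. f y))"
    by (simp add: integral_translate)
  also have "\<dots> = (LINT y|lborel. f y)"
    by simp
  finally show "(LINT y|lborel. f y) = (LINT y|lborel. LINT t|lborel. ?g y t)" by simp
qed

section \<open>Decay of the Fourier transform of the surface measure\<close>

text \<open>
  The first-derivative test. The phase \<open>\<phi> s = R s / \<surd>(s\<^sup>2 + b\<^sup>2)\<close> has derivative
  \<open>R b\<^sup>2 / (s\<^sup>2 + b\<^sup>2) powr (3/2)\<close>, which is at least \<open>R b\<^sup>2\<close> where \<open>s\<^sup>2 + b\<^sup>2 \<le> 1\<close>. Integration by parts against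
  its reciprocal leaves two boundary terms of size \<open>1 / (R b\<^sup>2)\<close> each and an integrand of size
  \<open>3 / (R b\<^sup>2)\<close> on an interval of length at most \<open>2\<close>.
\<close>

lemma norm_oscillatory_integral_le:
  fixes b R l r :: real
  assumes b: "0 < b" and R: "0 < R" and lr: "l \<le> r"
    and le1: "\<And>s. s \<in> {l..r} \<Longrightarrow> s\<^sup>2 + b\<^sup>2 \<le> 1"
  shows "norm (LINT s|lborel. indicator {l..r} s *\<^sub>R
           phase (R * s / sqrt (s\<^sup>2 + b\<^sup>2))) \<le> 8 / (R * b\<^sup>2)"
proof -
  define N where "N = (\<lambda>s. sqrt (s\<^sup>2 + b\<^sup>2))"
  define \<phi> where "\<phi> = (\<lambda>s. R * s / N s)"
  define E where "E = (\<lambda>s. phase (\<phi> s))"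
  \<comment> \<open>\<open>P\<close> is \<open>\<i> E / \<phi>'\<close>; its derivative is \<open>E\<close> plus the remainder \<open>Q\<close>.\<close>
  define P where "P = (\<lambda>s. complex_of_real (N s ^ 3 / (R * b\<^sup>2)) * (\<i> * E s))"
  define Q where "Q = (\<lambda>s. complex_of_real (3 * s * N s / (R * b\<^sup>2)) * (\<i> * E s))"
  have pos: "s\<^sup>2 + b\<^sup>2 > 0" for s
    using b by (simp add: add_nonneg_pos)
  have Npos: "N s > 0" for s
    using pos by (simp add: N_def)
  have N2: "(N s)\<^sup>2 = s\<^sup>2 + b\<^sup>2" for s
    using pos[of s] by (simp add: N_def)
  have dN: "(N has_real_derivative s / N s) (at s)" for s
    unfolding N_def using pos[of s]
    by (auto intro!: derivative_eq_intros simp: divide_simps)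
  have d\<phi>: "(\<phi> has_real_derivative R * b\<^sup>2 / N s ^ 3) (at s)" for s
  proof -
    have "(\<phi> has_real_derivative (R * N s - R * s * (s / N s)) / (N s * N s)) (at s)"
      unfolding \<phi>_def using Npos[of s]
      by (auto intro!: derivative_eq_intros dN)
    also have "(R * N s - R * s * (s / N s)) / (N s * N s) = R * ((N s)\<^sup>2 - s\<^sup>2) / N s ^ 3"
      using Npos[of s] by (simp add: field_simps power2_eq_square power3_eq_cube)
    finally show ?thesis
      by (simp add: N2)
  qed
  have dN3: "((\<lambda>s. N s ^ 3 / (R * b\<^sup>2)) has_real_derivative 3 * s * N s / (R * b\<^sup>2)) (at s)" for s
    using Npos[of s] R b
    by (auto intro!: derivative_eq_intros dN simp: field_simps power2_eq_square)
  have dE: "(E has_vector_derivative - (\<i> * of_real (R * b\<^sup>2 / N s ^ 3)) * E s) (at s)" for s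
  proof -
    have "((\<lambda>s. complex_of_real (\<phi> s)) has_vector_derivative of_real (R * b\<^sup>2 / N s ^ 3)) (at s)"
      using d\<phi>[of s] by (intro has_vector_derivative_of_real) (simp add: has_real_derivative_iff_has_vector_derivative)
    moreover have "((\<lambda>z. exp (- (\<i> * z))) has_field_derivative - \<i> * E s) (at (complex_of_real (\<phi> s)))"
      unfolding E_def by (auto intro!: derivative_eq_intros)
    ultimately have "((\<lambda>z. exp (- (\<i> * z))) \<circ> (\<lambda>s. complex_of_real (\<phi> s))
        has_vector_derivative of_real (R * b\<^sup>2 / N s ^ 3) * (- \<i> * E s)) (at s)"
      by (rule field_vector_diff_chain_at)
    thus ?thesis
      by (simp add: E_def o_def mult_ac)
  qed
  have dP: "(P has_vector_derivative E s + Q s) (at s)" for s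
  proof -
    have "((\<lambda>s. complex_of_real (N s ^ 3 / (R * b\<^sup>2))) has_vector_derivative
             of_real (3 * s * N s / (R * b\<^sup>2))) (at s)"
      using dN3[of s] by (intro has_vector_derivative_of_real) (simp add: has_real_derivative_iff_has_vector_derivative)
    from has_vector_derivative_mult[OF this has_vector_derivative_mult_right[OF dE[of s], of \<i>]]
    have "(P has_vector_derivative
        of_real (N s ^ 3 / (R * b\<^sup>2)) * (\<i> * (- (\<i> * of_real (R * b\<^sup>2 / N s ^ 3)) * E s)) + Q s) (at s)"
      by (simp add: P_def Q_def)
    moreover have "c * (\<i> * (- (\<i> * k) * z)) = z" if "c * k = 1" for c k z :: complex
    proof -
      have "c * (\<i> * (- (\<i> * k) * z)) = (c * k) * (- (\<i> * \<i>)) * z"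
        by algebra
      thus ?thesis using that by simp
    qed
    moreover have "complex_of_real (N s ^ 3 / (R * b\<^sup>2)) * of_real (R * b\<^sup>2 / N s ^ 3) = 1"
      unfolding of_real_mult[symmetric] using Npos[of s] R b by simp
    ultimately show ?thesis
      by metis
  qed
  have contN: "continuous_on A N" for A
    unfolding N_def by (intro continuous_intros)
  have contE: "continuous_on A E" for A
    by (intro continuous_at_imp_continuous_on ballI has_vector_derivative_continuous[OF dE])
  have contQ: "continuous_on A Q" for A
    unfolding Q_def using R b by (intro continuous_intros contN contE) auto
  have intE: "integrable lborel (\<lambda>s. indicator {l..r} s *\<^sub>R E s)"
    by (intro borel_integrable_compact contE) auto
  have intQ: "integrable lborel (\<lambda>s. indicator {l..r} s *\<^sub>R Q s)"
    by (intro borel_integrable_compact contQ) auto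
  have "(LINT s|lborel. indicator {l..r} s *\<^sub>R (E s + Q s)) = P r - P l"
    using lr by (intro integral_FTC_Icc has_vector_derivative_at_within[OF dP]
        continuous_intros contE contQ) auto
  hence eq: "(LINT s|lborel. indicator {l..r} s *\<^sub>R E s)
      = P r - P l - (LINT s|lborel. indicator {l..r} s *\<^sub>R Q s)"
    using intE intQ by (simp add: scaleR_right_distrib eq_diff_eq)
  have normE: "norm (E s) = 1" for s
    by (simp add: E_def)
  have N1: "N s \<le> 1" if "s \<in> {l..r}" for s
    using le1[OF that] by (simp add: N_def)
  have s1: "\<bar>s\<bar> \<le> 1" if "s \<in> {l..r}" for s
  proof -
    have "s\<^sup>2 \<le> 1" using le1[OF that] zero_le_power2[of b] by linarith
    thus ?thesis by (simp add: abs_square_le_1)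
  qed
  have normP: "norm (P s) \<le> 1 / (R * b\<^sup>2)" if "s \<in> {l..r}" for s
  proof -
    have "norm (P s) = N s ^ 3 / (R * b\<^sup>2)"
      using Npos[of s] R b by (simp add: P_def norm_mult normE norm_divide norm_power)
    thus ?thesis
      using N1[OF that] Npos[of s] R b by (auto intro!: divide_right_mono power_le_one)
  qed
  have normQ: "norm (Q s) \<le> 3 / (R * b\<^sup>2)" if "s \<in> {l..r}" for s
  proof -
    have "norm (Q s) = 3 * (\<bar>s\<bar> * N s) / (R * b\<^sup>2)"
      using Npos[of s] R b by (simp add: Q_def norm_mult normE norm_divide norm_power)
    moreover have "\<bar>s\<bar> * N s \<le> 1"
      using N1[OF that] s1[OF that] Npos[of s] by (simp add: mult_le_one)
    ultimately show ?thesis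
      using R b by (auto intro!: divide_right_mono)
  qed
  have "norm (LINT s|lborel. indicator {l..r} s *\<^sub>R Q s)
      \<le> (LINT s|lborel. (3 / (R * b\<^sup>2)) * indicator {l..r} s)"
    using normQ lr by (intro Bochner_Integration.integral_norm_bound_integral intQ
        integrable_mult_right integrable_real_indicator) (auto split: split_indicator)
  also have "\<dots> = (3 / (R * b\<^sup>2)) * (r - l)"
    using lr by simp
  also have "\<dots> \<le> (3 / (R * b\<^sup>2)) * 2"
    using s1[of l] s1[of r] lr R b by (intro mult_left_mono) auto
  finally have Qle: "norm (LINT s|lborel. indicator {l..r} s *\<^sub>R Q s) \<le> 6 / (R * b\<^sup>2)"
    by simp
  have "norm (P r - P l - (LINT s|lborel. indicator {l..r} s *\<^sub>R Q s))
      \<le> norm (P r) + norm (P l) + norm (LINT s|lborel. indicator {l..r} s *\<^sub>R Q s)"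
    by (meson norm_triangle_ineq4 add_right_mono order_trans)
  also have "\<dots> \<le> 1 / (R * b\<^sup>2) + 1 / (R * b\<^sup>2) + 6 / (R * b\<^sup>2)"
    using lr by (intro add_mono normP Qle) auto
  also have "\<dots> = 8 / (R * b\<^sup>2)"
    by (simp add: add_divide_distrib[symmetric])
  finally have "norm (LINT s|lborel. indicator {l..r} s *\<^sub>R E s) \<le> 8 / (R * b\<^sup>2)"
    unfolding eq .
  thus ?thesis
    by (simp add: E_def \<phi>_def N_def)
qed

abbreviation radial_phase :: "'a::euclidean_space \<Rightarrow> 'a \<Rightarrow> complex" where
  "radial_phase x y \<equiv> phase (x \<bullet> (y /\<^sub>R norm y))"

lemma radial_phase_measurable: "radial_phase x \<in> borel_measurable borel"
proof -
  have "(\<lambda>y. x \<bullet> (y /\<^sub>R norm y)) \<in> borel_measurable borel"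
    by (intro borel_measurable_inner borel_measurable_scaleR borel_measurable_inverse
        borel_measurable_norm) auto
  moreover have "phase \<in> borel_measurable borel"
    by (intro borel_measurable_continuous_onI continuous_intros)
  ultimately show ?thesis
    by (rule measurable_compose)
qed

text \<open>
  With \<open>a = y \<bullet> u\<close> and \<open>b\<close> the distance from \<open>y\<close> to the line spanned by \<open>u\<close>, the phase at \<open>y + t u\<close> is
  \<open>R s / \<surd>(s\<^sup>2 + b\<^sup>2)\<close> for \<open>s = t + a\<close>. The direction \<open>v\<close> orthogonal to \<open>u\<close> is there because
  \<open>\<bar>y \<bullet> v\<bar> \<le> b\<close>: the bad points with small \<open>b\<close> then lie in a slab, whose volume is easy to estimate.
\<close>

lemma norm_segment_integral_le:
  fixes u v y :: "'a::euclidean_space"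
  assumes u: "norm u = 1" and v: "norm v = 1" and uv: "u \<bullet> v = 0"
    and \<delta>: "0 < \<delta>" "\<delta> \<le> \<bar>y \<bullet> v\<bar>" and R: "0 < R"
  shows "norm (LINT t|lborel. indicator {0..1::real} t *\<^sub>R
      (indicator (cball 0 1) (y + t *\<^sub>R u) *\<^sub>R radial_phase (R *\<^sub>R u) (y + t *\<^sub>R u)))
      \<le> 8 / (R * \<delta>\<^sup>2)" (is "norm ?I \<le> _")
proof -
  define a where "a = y \<bullet> u"
  define b where "b = norm (y - a *\<^sub>R u)"
  have "\<bar>y \<bullet> v\<bar> = \<bar>(y - a *\<^sub>R u) \<bullet> v\<bar>"
    using uv by (simp add: inner_diff_left)
  also have "\<dots> \<le> b"
    unfolding b_def using Cauchy_Schwarz_ineq2[of "y - a *\<^sub>R u" v] v by simp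
  finally have b: "\<delta> \<le> b" using \<delta> by simp
  have uu: "u \<bullet> u = 1"
    using u by (simp add: norm_eq_1)
  have nrm: "norm (y + t *\<^sub>R u) = sqrt ((t + a)\<^sup>2 + b\<^sup>2)" for t
  proof -
    have "(norm (y + t *\<^sub>R u))\<^sup>2 = (t + a)\<^sup>2 + b\<^sup>2"
      unfolding b_def power2_norm_eq_inner a_def
      by (simp add: inner_diff inner_add uu inner_commute[of u y] power2_eq_square algebra_simps)
    thus ?thesis by (metis norm_ge_zero real_sqrt_unique)
  qed
  have inn: "(R *\<^sub>R u) \<bullet> (y + t *\<^sub>R u) = R * (t + a)" for t
    by (simp add: inner_add_right uu a_def inner_commute[of u y] algebra_simps)
  define G where "G = (\<lambda>s. phase (R * s / sqrt (s\<^sup>2 + b\<^sup>2)))"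
  \<comment> \<open>The part of the segment inside the unit ball, in the variable \<open>s\<close>. It is an interval.\<close>
  define J where "J = {s. s - a \<in> {0..1} \<and> s\<^sup>2 + b\<^sup>2 \<le> 1}"
  have [measurable]: "G \<in> borel_measurable borel"
    unfolding G_def by measurable
  have [measurable]: "J \<in> sets borel"
    unfolding J_def by measurable
  have "?I = (LINT t|lborel. indicator J (t + a) *\<^sub>R G (t + a))"
  proof (intro Bochner_Integration.integral_cong refl)
    fix t :: real
    show "indicator {0..1::real} t *\<^sub>R
      (indicator (cball 0 1) (y + t *\<^sub>R u) *\<^sub>R radial_phase (R *\<^sub>R u) (y + t *\<^sub>R u))
      = indicator J (t + a) *\<^sub>R G (t + a)"
      unfolding inner_scaleR_right inn nrm
      by (auto simp: indicator_def nrm J_def G_def divide_inverse mult_ac)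
  qed
  also have "\<dots> = (LINT s|lborel. indicator J s *\<^sub>R G s)"
    by (rule integral_translate) measurable
  finally have I: "?I = (LINT s|lborel. indicator J s *\<^sub>R G s)" .
  have "norm ?I \<le> 8 / (R * b\<^sup>2)"
  proof (cases "J = {}")
    case True
    thus ?thesis using I R by simp
  next
    case False
    then obtain s0 where s0: "s0 \<in> J" by blast
    define c where "c = sqrt (1 - b\<^sup>2)"
    have b1: "b\<^sup>2 \<le> 1"
      using s0 zero_le_power2[of s0] unfolding J_def by (auto intro: order_trans[rotated])
    have sq: "s\<^sup>2 + b\<^sup>2 \<le> 1 \<longleftrightarrow> \<bar>s\<bar> \<le> c" for s
    proof -
      have "s\<^sup>2 + b\<^sup>2 \<le> 1 \<longleftrightarrow> sqrt (s\<^sup>2) \<le> c"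
        unfolding c_def real_sqrt_le_iff by linarith
      thus ?thesis by simp
    qed
    have J: "J = {max a (- c)..min (a + 1) c}"
      unfolding J_def sq by (auto simp: abs_le_iff)
    show ?thesis
      unfolding I J G_def
    proof (rule norm_oscillatory_integral_le)
      show "0 < b" using b \<delta> by simp
      show "max a (- c) \<le> min (a + 1) c" using s0 J by auto
      show "s\<^sup>2 + b\<^sup>2 \<le> 1" if "s \<in> {max a (- c)..min (a + 1) c}" for s
      proof -
        have "s \<in> J" unfolding J by (rule that)
        thus ?thesis by (simp add: J_def)
      qed
    qed (rule R)
  qed
  also have "\<dots> \<le> 8 / (R * \<delta>\<^sup>2)"
  proof (rule frac_le)
    show "R * \<delta>\<^sup>2 \<le> R * b\<^sup>2"
      using b \<delta> R by (simp add: power_mono)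
  qed (use R \<delta> in auto)
  finally show ?thesis .
qed

lemma slab_borel:
  fixes v :: "'a::euclidean_space"
  shows "{y \<in> cball 0 r. \<bar>y \<bullet> v\<bar> < \<delta>} \<in> sets borel"
proof -
  have "open {y. \<bar>y \<bullet> v\<bar> < \<delta>}"
    by (intro open_Collect_less continuous_intros)
  moreover have "{y \<in> cball 0 r. \<bar>y \<bullet> v\<bar> < \<delta>} = cball 0 r \<inter> {y. \<bar>y \<bullet> v\<bar> < \<delta>}"
    by auto
  ultimately show ?thesis
    by simp
qed

text \<open>
  Averaging along the normal \<open>v\<close>: each line in this direction meets the slab in length at most
  \<open>2 \<delta>\<close>, and a unit translate of a point of the ball of radius \<open>2\<close> stays in the ball of radius \<open>3\<close>.
\<close>

lemma measure_slab_le: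
  fixes v :: "'a::euclidean_space"
  assumes v: "norm v = 1" and \<delta>: "0 < \<delta>"
  shows "measure lborel {y \<in> cball 0 2. \<bar>y \<bullet> v\<bar> < \<delta>} \<le> 2 * \<delta> * measure lborel (cball (0::'a) 3)"
proof -
  let ?S = "{y \<in> cball 0 2. \<bar>y \<bullet> v\<bar> < \<delta>}"
  have [measurable]: "?S \<in> sets borel"
    by (rule slab_borel)
  have "emeasure lborel ?S = (\<integral>\<^sup>+y. indicator ?S y \<partial>lborel)"
    by simp
  also have "\<dots> = (\<integral>\<^sup>+y. (\<integral>\<^sup>+t. indicator ?S (y + t *\<^sub>R v) * indicator {0..1::real} t \<partial>lborel) \<partial>lborel)"
    by (rule nn_integral_average_translates) measurable
  also have "\<dots> \<le> (\<integral>\<^sup>+(y::'a). ennreal (2 * \<delta>) * indicator (cball 0 3) y \<partial>lborel)"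
  proof (rule nn_integral_mono)
    fix y :: 'a
    have "(\<integral>\<^sup>+t. indicator ?S (y + t *\<^sub>R v) * indicator {0..1::real} t \<partial>lborel)
        \<le> (\<integral>\<^sup>+t. indicator (cball 0 3) y * indicator {- \<delta> - y \<bullet> v..\<delta> - y \<bullet> v} t \<partial>lborel)"
    proof (rule nn_integral_mono)
      fix t :: real
      have "y \<in> cball 0 3" if "y + t *\<^sub>R v \<in> cball 0 2" "t \<in> {0..1}"
      proof -
        have "norm y \<le> norm (y + t *\<^sub>R v) + norm (t *\<^sub>R v)"
          using norm_triangle_ineq4[of "y + t *\<^sub>R v" "t *\<^sub>R v"] by simp
        thus ?thesis using that v by simp
      qed
      moreover have "(y + t *\<^sub>R v) \<bullet> v = y \<bullet> v + t"
        using v by (simp add: inner_add_left norm_eq_1)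
      ultimately show "indicator ?S (y + t *\<^sub>R v) * indicator {0..1::real} t
          \<le> (indicator (cball 0 3) y * indicator {- \<delta> - y \<bullet> v..\<delta> - y \<bullet> v} t :: ennreal)"
        by (auto simp: indicator_def)
    qed
    also have "\<dots> = ennreal (2 * \<delta>) * indicator (cball 0 3) y"
      using \<delta> by (simp add: nn_integral_cmult_indicator mult.commute)
    finally show "(\<integral>\<^sup>+t. indicator ?S (y + t *\<^sub>R v) * indicator {0..1::real} t \<partial>lborel)
      \<le> ennreal (2 * \<delta>) * indicator (cball 0 3) y" .
  qed
  also have "\<dots> = ennreal (2 * \<delta>) * emeasure lborel (cball (0::'a) 3)"
    by (simp add: nn_integral_cmult_indicator)
  also have "\<dots> = ennreal (2 * \<delta> * measure lborel (cball (0::'a) 3))"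
    using \<delta> by (simp add: emeasure_cball content_cball ennreal_mult')
  finally show ?thesis
    using \<delta> by (simp add: measure_def enn2real_leI)
qed

text \<open>
  The ball is closed here so that every line meets it in a closed interval or not at all, which is
  the form in which the fundamental theorem of calculus applies.
\<close>

lemma sphere_fourier_eq_ball_integral:
  "sphere_fourier (x::'a::euclidean_space) =
     real DIM('a) *\<^sub>R (LINT y|lborel. indicator (cball 0 1) y *\<^sub>R radial_phase x y)"
proof -
  have "sphere_fourier x = real DIM('a) *\<^sub>R
      (LINT y|lborel. indicator (ball 0 1 - {0}) y *\<^sub>R radial_phase x y)"
    unfolding extension_def by (subst integral_sphere_measure) auto
  also have "(LINT y|lborel. indicator (ball 0 1 - {0}) y *\<^sub>R radial_phase x y)
      = (LINT y|lborel. indicator (cball 0 1) y *\<^sub>R radial_phase x y)"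
  proof (rule integral_cong_AE)
    have "negligible (sphere (0::'a) 1 \<union> {0})"
      by (intro negligible_Un negligible_sphere negligible_sing)
    hence "emeasure lborel (sphere (0::'a) 1 \<union> {0}) = 0"
      by (subst (asm) negligible_iff_emeasure0) auto
    hence "AE y in lborel. y \<notin> sphere (0::'a) 1 \<union> {0}"
      by (intro AE_not_in) (auto simp: null_sets_def)
    thus "AE y in lborel. indicator (ball 0 1 - {0}) y *\<^sub>R radial_phase x y
        = indicator (cball 0 1) y *\<^sub>R radial_phase x y"
      by eventually_elim (auto simp: indicator_def)
  qed (auto intro!: borel_measurable_scaleR borel_measurable_indicator radial_phase_measurable)
  finally show ?thesis .
qed

text \<open>
  Decay of order \<open>1/3\<close>, stated with the decay parameter \<open>\<delta>\<close> as the variable so that only integer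
  powers occur. The averaged integrand is \<open>O(1 / (R \<delta>\<^sup>2))\<close> off a slab of volume \<open>O(\<delta>)\<close>, and it is at
  most \<open>1\<close> on the slab; both contributions are \<open>O(\<delta>)\<close> as soon as \<open>R \<ge> 1 / \<delta> ^ 3\<close>. The hypothesis
  on the dimension provides a direction orthogonal to \<open>x\<close>; in dimension one there is no decay.
\<close>

theorem sphere_fourier_decay:
  assumes dim: "2 \<le> DIM('a::euclidean_space)"
  obtains C where "0 < C"
    and "\<And>\<delta> x::'a. 0 < \<delta> \<Longrightarrow> 1 / \<delta> ^ 3 \<le> norm x \<Longrightarrow> norm (sphere_fourier x) \<le> C * \<delta>"
proof -
  define V where "V = (\<lambda>r. measure lborel (cball (0::'a) r))"
  define C where "C = real DIM('a) * (8 * V 2 + 2 * V 3)"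
  have Vpos: "V r > 0" if "r > 0" for r
    using that unfolding V_def by (simp add: content_cball)
  show ?thesis
  proof (rule that)
    show "0 < C"
      unfolding C_def by (simp add: Vpos add_pos_pos)
  next
    fix \<delta> :: real and x :: 'a
    assume \<delta>: "0 < \<delta>" and x: "1 / \<delta> ^ 3 \<le> norm x"
    define R where "R = norm x"
    have R: "0 < R" using \<delta> x unfolding R_def by (smt (verit) divide_pos_pos zero_less_power)
    define u where "u = x /\<^sub>R R"
    have u: "norm u = 1" using R by (simp add: u_def R_def)
    have xu: "x = R *\<^sub>R u" using R by (simp add: u_def)
    obtain S where S: "u \<in> S" "pairwise orthogonal S" "\<And>x. x \<in> S \<Longrightarrow> norm x = 1"
        "independent S" "card S = DIM('a)" "span S = UNIV"
      by (rule vector_in_orthonormal_basis[OF u]) metis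
    have "\<not> S \<subseteq> {u}"
      using dim S(5) card_mono[of "{u}" S] by auto
    then obtain v where v: "v \<in> S" "v \<noteq> u" by blast
    have uv: "u \<bullet> v = 0" and nv: "norm v = 1"
      using S v by (auto simp: pairwise_def orthogonal_def)
    define G where "G = (\<lambda>y. indicator (cball 0 1) y *\<^sub>R radial_phase x y)"
    have G1: "norm (G y) \<le> 1" for y
      by (simp add: G_def indicator_def)
    have G: "integrable lborel G"
      unfolding G_def
    proof (rule integrableI_bounded_set_indicator[where B=1])
      show "emeasure lborel (cball (0::'a) 1) < \<infinity>"
        by (rule emeasure_lborel_cball_finite)
    qed (auto simp: radial_phase_measurable)
    define H where "H = (\<lambda>y. LINT t|lborel. indicator {0..1::real} t *\<^sub>R G (y + t *\<^sub>R u))"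
    have H: "integrable lborel H" "integral\<^sup>L lborel G = integral\<^sup>L lborel H"
      unfolding H_def using integral_average_translates[OF G, of u] by auto
    define D where "D = {y \<in> cball 0 2. \<bar>y \<bullet> v\<bar> < \<delta>}"
    have Dm: "D \<in> sets lborel" unfolding D_def by (simp add: slab_borel)
    have Df: "emeasure lborel D < \<infinity>"
      by (rule le_less_trans[OF emeasure_mono emeasure_lborel_cball_finite[of 0 2]]) (auto simp: D_def)
    have Hle: "norm (H y) \<le> indicator (cball 0 2) y * (8 * \<delta>) + indicator D y" for y
    proof (cases "y \<in> cball 0 2")
      case False
      have "indicator {0..1::real} t *\<^sub>R G (y + t *\<^sub>R u) = 0" for t
      proof (cases "t \<in> {0..1}")
        case True
        have "norm y \<le> norm (y + t *\<^sub>R u) + norm (t *\<^sub>R u)"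
          using norm_triangle_ineq4[of "y + t *\<^sub>R u" "t *\<^sub>R u"] by simp
        hence "y + t *\<^sub>R u \<notin> cball 0 1"
          using False True u by auto
        thus ?thesis by (simp add: G_def)
      qed auto
      hence "H y = 0"
        unfolding H_def by (simp only: Bochner_Integration.integral_zero)
      thus ?thesis
        using \<delta> by simp
    next
      case y: True
      show ?thesis
      proof (cases "\<bar>y \<bullet> v\<bar> < \<delta>")
        case True
        have "norm (H y) \<le> (LINT t|lborel. indicator {0..1::real} t)"
          unfolding H_def
        proof (rule Bochner_Integration.integral_norm_bound_integral)
          have [measurable]: "G \<in> borel_measurable borel" using G by simp
          show "integrable lborel (\<lambda>t. indicator {0..1::real} t *\<^sub>R G (y + t *\<^sub>R u))"
            by (rule integrableI_bounded_set_indicator[where B=1]) (auto simp: G1)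
          show "norm (indicator {0..1::real} t *\<^sub>R G (y + t *\<^sub>R u)) \<le> indicator {0..1} t" for t
            using G1 by (auto simp: indicator_def)
        qed auto
        also have "\<dots> = 1" by simp
        also have "\<dots> \<le> indicator (cball 0 2) y * (8 * \<delta>) + indicator D y"
          using y True \<delta> by (simp add: D_def)
        finally show ?thesis .
      next
        case False
        hence "\<delta> \<le> \<bar>y \<bullet> v\<bar>" by simp
        from norm_segment_integral_le[OF u nv uv \<delta> this R]
        have "norm (H y) \<le> 8 / (R * \<delta>\<^sup>2)"
          unfolding H_def G_def xu .
        also have "\<dots> \<le> 8 * \<delta>"
        proof -
          have "1 \<le> R * \<delta> ^ 3"
            using x \<delta> unfolding R_def[symmetric] by (simp add: field_simps)
          thus ?thesis
            using R \<delta> by (simp add: field_simps power3_eq_cube power2_eq_square)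
        qed
        finally show ?thesis using y by (simp add: indicator_def)
      qed
    qed
    have int1: "integrable lborel (\<lambda>y::'a. indicator (cball 0 2) y * (8 * \<delta>))"
      by (intro integrable_mult_left integrable_real_indicator emeasure_lborel_cball_finite) simp
    have int2: "integrable lborel (\<lambda>y::'a. indicator D y :: real)"
      by (intro integrable_real_indicator Dm Df)
    have "norm (integral\<^sup>L lborel H) \<le> (LINT y|lborel. indicator (cball 0 2) y * (8 * \<delta>) + indicator D y)"
      by (rule Bochner_Integration.integral_norm_bound_integral
          [OF H(1) Bochner_Integration.integrable_add[OF int1 int2] Hle])
    also have "\<dots> = V 2 * (8 * \<delta>) + measure lborel D"
      unfolding Bochner_Integration.integral_add[OF int1 int2] by (simp add: V_def)
    also have "\<dots> \<le> V 2 * (8 * \<delta>) + 2 * \<delta> * V 3"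
      unfolding D_def V_def using measure_slab_le[OF nv \<delta>] by simp
    finally have "norm (integral\<^sup>L lborel G) \<le> (8 * V 2 + 2 * V 3) * \<delta>"
      unfolding H(2) by (simp add: algebra_simps)
    hence "real DIM('a) * norm (integral\<^sup>L lborel G) \<le> C * \<delta>"
      unfolding C_def by simp
    thus "norm (sphere_fourier x) \<le> C * \<delta>"
      unfolding sphere_fourier_eq_ball_integral G_def by simp
  qed
qed

section \<open>Duality\<close>

definition fourier :: "('a::euclidean_space \<Rightarrow> complex) \<Rightarrow> 'a \<Rightarrow> complex" where
  "fourier s \<omega> = (LINT x|lborel. s x * phase (x \<bullet> \<omega>))"

interpretation lborel_sphere: pair_sigma_finite
  "lborel :: 'a::euclidean_space measure" "sphere_measure :: 'a measure" ..

lemma measurable_inner_sphere [measurable]: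
  "(\<lambda>\<omega>. x \<bullet> \<omega>) \<in> borel_measurable (sphere_measure :: 'a::euclidean_space measure)"
  by (rule measurable_sphere_measure) measurable

lemma extension_measurable:
  fixes f :: "'a::euclidean_space \<Rightarrow> complex"
  assumes [measurable]: "f \<in> borel_measurable sphere_measure"
  shows "extension f \<in> borel_measurable borel"
proof -
  have "(\<lambda>x. LINT \<omega>|sphere_measure. f \<omega> * phase (x \<bullet> \<omega>)) \<in> borel_measurable (lborel :: 'a measure)"
  proof (rule sphere.borel_measurable_lebesgue_integral)
    have "(\<lambda>p. f (snd p) * phase (fst p \<bullet> snd p)) \<in> borel_measurable (lborel \<Otimes>\<^sub>M sphere_measure)"
      by (intro borel_measurable_times measurable_phase) measurable
    thus "(\<lambda>(x, \<omega>). f \<omega> * phase (x \<bullet> \<omega>)) \<in> borel_measurable (lborel \<Otimes>\<^sub>M sphere_measure)"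
      by (simp add: case_prod_beta)
  qed
  thus ?thesis
    by (simp add: extension_def[abs_def])
qed

text \<open>
  The transpose of the extension operator is the Fourier transform restricted to the sphere.
\<close>

lemma
  fixes f s :: "'a::euclidean_space \<Rightarrow> complex"
  assumes s: "integrable lborel s" and f: "integrable sphere_measure f"
  shows duality: "(LINT x|lborel. s x * extension f x) = (LINT \<omega>|sphere_measure. f \<omega> * fourier s \<omega>)"
    and integrable_mult_extension: "integrable lborel (\<lambda>x. s x * extension f x)"
proof -
  let ?K = "\<lambda>x \<omega>. s x * (f \<omega> * phase (x \<bullet> \<omega>))"
  have [measurable]: "s \<in> borel_measurable borel" "f \<in> borel_measurable sphere_measure"
    using s f by auto
  have "(\<lambda>p. s (fst p) * (f (snd p) * phase (fst p \<bullet> snd p))) \<in> borel_measurable (lborel \<Otimes>\<^sub>M sphere_measure)"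
    by (intro borel_measurable_times measurable_phase) measurable
  hence Km: "case_prod ?K \<in> borel_measurable (lborel \<Otimes>\<^sub>M sphere_measure)"
    by (simp add: case_prod_beta)
  have K: "integrable (lborel \<Otimes>\<^sub>M sphere_measure) (case_prod ?K)"
  proof (rule integrableI_bounded)
    have "(\<integral>\<^sup>+p. ennreal (norm (case_prod ?K p)) \<partial>(lborel \<Otimes>\<^sub>M sphere_measure))
        = (\<integral>\<^sup>+x. \<integral>\<^sup>+\<omega>. ennreal (norm (?K x \<omega>)) \<partial>sphere_measure \<partial>lborel)"
      using Km by (subst sphere.nn_integral_fst[symmetric]) auto
    also have "\<dots> = (\<integral>\<^sup>+x. \<integral>\<^sup>+\<omega>. ennreal (norm (s x)) * ennreal (norm (f \<omega>)) \<partial>sphere_measure \<partial>lborel)"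
      by (simp add: norm_mult ennreal_mult)
    also have "\<dots> = (\<integral>\<^sup>+x. ennreal (norm (s x)) \<partial>lborel) * (\<integral>\<^sup>+\<omega>. ennreal (norm (f \<omega>)) \<partial>sphere_measure)"
      by (simp add: nn_integral_cmult nn_integral_multc)
    also have "\<dots> < \<infinity>"
      using s f by (simp add: integrable_iff_bounded ennreal_mult_less_top)
    finally show "(\<integral>\<^sup>+p. ennreal (norm (case_prod ?K p)) \<partial>(lborel \<Otimes>\<^sub>M sphere_measure)) < \<infinity>" .
  qed (rule Km)
  have ext: "(LINT \<omega>|sphere_measure. ?K x \<omega>) = s x * extension f x" for x
    by (simp add: extension_def)
  have four: "(LINT x|lborel. ?K x \<omega>) = f \<omega> * fourier s \<omega>" for \<omega>
    unfolding fourier_def by (simp add: mult.left_commute)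
  show "integrable lborel (\<lambda>x. s x * extension f x)"
    using lborel_sphere.integrable_fst[OF K] unfolding ext .
  show "(LINT x|lborel. s x * extension f x) = (LINT \<omega>|sphere_measure. f \<omega> * fourier s \<omega>)"
    using lborel_sphere.Fubini_integral[OF K] unfolding ext four by simp
qed

lemma norm_fourier_le: "norm (fourier s \<omega>) \<le> (LINT x|lborel. norm (s x))"
proof -
  have "norm (fourier s \<omega>) \<le> (LINT x|lborel. norm (s x * phase (x \<bullet> \<omega>)))"
    unfolding fourier_def by (rule integral_norm_bound)
  thus ?thesis by (simp add: norm_mult)
qed

lemma fourier_measurable:
  fixes s :: "'a::euclidean_space \<Rightarrow> complex"
  assumes [measurable]: "s \<in> borel_measurable borel"
  shows "fourier s \<in> borel_measurable sphere_measure"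
proof (rule measurable_sphere_measure)
  have "(\<lambda>\<omega>. LINT x|lborel. s x * phase (x \<bullet> \<omega>)) \<in> borel_measurable (borel :: 'a measure)"
    by (rule lborel.borel_measurable_lebesgue_integral) measurable
  thus "fourier s \<in> borel_measurable borel"
    by (simp add: fourier_def[abs_def])
qed

lemma integrable_sphere_bounded:
  fixes g :: "'a::euclidean_space \<Rightarrow> complex"
  assumes "g \<in> borel_measurable sphere_measure" "\<And>\<omega>. norm (g \<omega>) \<le> B"
  shows "integrable sphere_measure g"
  using assms by (intro sphere.integrable_const_bound[where B=B]) auto

lemma cnj_measurable: "cnj \<in> borel_measurable borel"
  by (intro borel_measurable_continuous_onI continuous_on_cnj continuous_on_id)

text \<open>
  The \<open>T T\<^sup>*\<close> argument: the squared norm of the restricted transform of \<open>s\<close> is the integral over \<open>x\<close>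
  and \<open>y\<close> of \<open>s x\<close>, the conjugate of \<open>s y\<close>, and a value of the transform of \<open>\<sigma>\<close> at the difference of
  \<open>x\<close> and \<open>y\<close>. Instead of a threefold Fubini theorem the proof uses duality twice: with
  the conjugate \<open>g\<close> of the transform of \<open>s\<close> in the role of \<open>f\<close>, and then with the character \<open>e\<close>, whose extension is
  a translate of the transform of \<open>\<sigma>\<close>.
\<close>

lemma integral_norm_fourier_sq_le:
  fixes s :: "'a::euclidean_space \<Rightarrow> complex"
  assumes s: "integrable lborel s"
    and B: "\<And>x. (LINT y|lborel. norm (s y) * norm (sphere_fourier (y - x))) \<le> B"
  shows "(LINT \<omega>|sphere_measure. (norm (fourier s \<omega>))\<^sup>2) \<le> B * (LINT x|lborel. norm (s x))"
proof -
  have sm: "s \<in> borel_measurable borel"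
    using s by simp
  have [measurable]: "fourier s \<in> borel_measurable sphere_measure"
    by (rule fourier_measurable[OF sm])
  define g where "g = (\<lambda>\<omega>. cnj (fourier s \<omega>))"
  have gm [measurable]: "g \<in> borel_measurable sphere_measure"
    unfolding g_def by (rule measurable_compose[OF _ cnj_measurable]) measurable
  have g: "integrable sphere_measure g"
    using norm_fourier_le[of s] by (intro integrable_sphere_bounded[OF gm]) (simp add: g_def)
  have ext_g: "norm (extension g x) \<le> B" for x
  proof -
    define e where "e = (\<lambda>\<omega>. cnj (phase (x \<bullet> \<omega>)))"
    have e_eq: "e \<omega> = exp (\<i> * complex_of_real (x \<bullet> \<omega>))" for \<omega>
      by (simp add: e_def exp_cnj)
    have em: "e \<in> borel_measurable sphere_measure"
      unfolding e_eq[abs_def] by measurable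
    have e: "integrable sphere_measure e"
      using em by (rule integrable_sphere_bounded[where B=1]) (simp add: e_def)
    have ext_e: "extension e y = sphere_fourier (y - x)" for y
      unfolding extension_def e_eq exp_add[symmetric]
      by (intro Bochner_Integration.integral_cong)
        (auto simp: inner_diff_left algebra_simps exp_add[symmetric])
    have "cnj (extension g x) = (LINT \<omega>|sphere_measure. cnj (g \<omega> * phase (x \<bullet> \<omega>)))"
      unfolding extension_def by (rule Bochner_Integration.integral_cnj[symmetric])
    also have "\<dots> = (LINT \<omega>|sphere_measure. e \<omega> * fourier s \<omega>)"
      by (simp add: g_def e_def mult.commute)
    also have "\<dots> = (LINT y|lborel. s y * sphere_fourier (y - x))"
      using duality[OF s e] by (simp add: ext_e)
    finally have "norm (extension g x) = norm (LINT y|lborel. s y * sphere_fourier (y - x))"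
      by (metis complex_mod_cnj)
    also have "\<dots> \<le> (LINT y|lborel. norm (s y * sphere_fourier (y - x)))"
      by (rule integral_norm_bound)
    also have "\<dots> \<le> B"
      using B[of x] by (simp add: norm_mult)
    finally show ?thesis .
  qed
  have "complex_of_real (LINT \<omega>|sphere_measure. (norm (fourier s \<omega>))\<^sup>2)
      = (LINT \<omega>|sphere_measure. g \<omega> * fourier s \<omega>)"
    unfolding g_def integral_complex_of_real[symmetric]
    by (simp add: complex_norm_square[symmetric] mult.commute)
  also have "\<dots> = (LINT x|lborel. s x * extension g x)"
    by (rule duality[OF s g, symmetric])
  finally have "norm (complex_of_real (LINT \<omega>|sphere_measure. (norm (fourier s \<omega>))\<^sup>2))
      = norm (LINT x|lborel. s x * extension g x)" by simp
  hence "\<bar>LINT \<omega>|sphere_measure. (norm (fourier s \<omega>))\<^sup>2\<bar> = norm (LINT x|lborel. s x * extension g x)"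
    unfolding norm_of_real .
  also have "\<dots> \<le> (LINT x|lborel. norm (s x) * B)"
    using ext_g s
    by (intro Bochner_Integration.integral_norm_bound_integral integrable_mult_extension g)
      (auto simp: norm_mult intro: mult_left_mono)
  finally show ?thesis
    by (simp add: mult.commute)
qed

lemma Cauchy_Schwarz_integral:
  fixes f g :: "'a \<Rightarrow> complex"
  assumes [measurable]: "f \<in> borel_measurable M" "g \<in> borel_measurable M"
    and f: "integrable M (\<lambda>x. (norm (f x))\<^sup>2)" and g: "integrable M (\<lambda>x. (norm (g x))\<^sup>2)"
  shows "(norm (LINT x|M. f x * g x))\<^sup>2 \<le> (LINT x|M. (norm (f x))\<^sup>2) * (LINT x|M. (norm (g x))\<^sup>2)"
proof -
  have "ennreal (norm (LINT x|M. f x * g x)) \<le> (\<integral>\<^sup>+x. ennreal (norm (f x * g x)) \<partial>M)"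
    by (cases "integrable M (\<lambda>x. f x * g x)")
      (auto intro: integral_norm_bound_ennreal simp: not_integrable_integral_eq)
  also have "\<dots> = (\<integral>\<^sup>+x. ennreal (norm (f x)) * ennreal (norm (g x)) \<partial>M)"
    by (simp add: norm_mult ennreal_mult)
  finally have "(ennreal (norm (LINT x|M. f x * g x)))\<^sup>2
      \<le> (\<integral>\<^sup>+x. ennreal (norm (f x)) * ennreal (norm (g x)) \<partial>M)\<^sup>2"
    by (rule power_mono) simp
  also have "\<dots> \<le> (\<integral>\<^sup>+x. (ennreal (norm (f x)))\<^sup>2 \<partial>M) * (\<integral>\<^sup>+x. (ennreal (norm (g x)))\<^sup>2 \<partial>M)"
    by (rule Cauchy_Schwarz_nn_integral) auto
  also have "\<dots> = ennreal ((LINT x|M. (norm (f x))\<^sup>2) * (LINT x|M. (norm (g x))\<^sup>2))"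
    using nn_integral_eq_integral[OF f] nn_integral_eq_integral[OF g]
    by (simp add: ennreal_power ennreal_mult)
  finally show ?thesis
    by (simp add: ennreal_power)
qed

definition sphere_L2 :: "('a::euclidean_space \<Rightarrow> complex) \<Rightarrow> real" where
  "sphere_L2 f = sqrt (LINT \<omega>|sphere_measure. (norm (f \<omega>))\<^sup>2)"

lemma sphere_L2_sq: "(sphere_L2 f)\<^sup>2 = (LINT \<omega>|sphere_measure. (norm (f \<omega>))\<^sup>2)"
  by (simp add: sphere_L2_def)

lemma sphere_L2_nonneg: "0 \<le> sphere_L2 f"
  by (simp add: sphere_L2_def)

lemma norm_extension_le:
  fixes f :: "'a::euclidean_space \<Rightarrow> complex"
  assumes [measurable]: "f \<in> borel_measurable sphere_measure"
    and f2: "integrable sphere_measure (\<lambda>\<omega>. (norm (f \<omega>))\<^sup>2)"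
  shows "norm (extension f x) \<le> sqrt (sphere_area TYPE('a)) * sphere_L2 f"
proof -
  have "(norm (extension f x))\<^sup>2 \<le> (LINT \<omega>|sphere_measure. (norm (f \<omega>))\<^sup>2)
      * (LINT \<omega>|sphere_measure. (norm (phase (x \<bullet> \<omega>)))\<^sup>2)"
    unfolding extension_def by (rule Cauchy_Schwarz_integral) (auto simp: f2)
  also have "\<dots> = (sqrt (sphere_area TYPE('a)) * sphere_L2 f)\<^sup>2"
    using sphere_area_pos[where 'a='a]
    by (simp add: power_mult_distrib sphere_L2_sq space_sphere_measure measure_sphere)
  finally show ?thesis
    by (rule power2_le_imp_le)
      (use sphere_area_pos[where 'a='a] in \<open>simp add: sphere_L2_nonneg\<close>)
qed

lemma integrable_of_norm_sq:
  fixes f :: "'a::euclidean_space \<Rightarrow> complex"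
  assumes [measurable]: "f \<in> borel_measurable sphere_measure"
    and f2: "integrable sphere_measure (\<lambda>\<omega>. (norm (f \<omega>))\<^sup>2)"
  shows "integrable sphere_measure f"
proof (rule Bochner_Integration.integrable_bound)
  show "integrable sphere_measure (\<lambda>\<omega>. 1 + (norm (f \<omega>))\<^sup>2)"
    using f2 by simp
  have "t \<le> 1 + t\<^sup>2" for t :: real
  proof -
    have "2 * t \<le> t\<^sup>2 + 1"
      using zero_le_power2[of "t - 1"] by (simp add: power2_diff)
    thus ?thesis using zero_le_power2[of t] by linarith
  qed
  thus "AE \<omega> in sphere_measure. norm (f \<omega>) \<le> norm (1 + (norm (f \<omega>))\<^sup>2)"
    by auto
qed simp

section \<open>The weak-type estimate\<close>

text \<open>
  The test function \<open>s\<close> is the conjugate phase of \<open>h\<close> on \<open>E\<close>, so that pairing it with \<open>h\<close> gives the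
  integral of \<open>\<bar>h\<bar>\<close> over \<open>E\<close>, at least \<open>\<tau> \<bar>E\<bar>\<close>. By duality and Cauchy--Schwarz this is at most \<open>F\<close>
  times the norm of the restricted transform of \<open>s\<close>. In the resulting kernel integral over \<open>E\<close>, the points
  within \<open>1 / \<delta> ^ 3\<close> of the centre contribute at most \<open>A\<close> times the volume of a ball, and the others
  at most \<open>C \<delta> \<bar>E\<bar>\<close> by decay. One factor \<open>\<bar>E\<bar>\<close> cancels.
\<close>

lemma level_subset_bound:
  fixes f :: "'a::euclidean_space \<Rightarrow> complex"
  assumes decay: "\<And>x::'a. 1 / \<delta> ^ 3 \<le> norm x \<Longrightarrow> norm (sphere_fourier x) \<le> C * \<delta>"
    and \<delta>: "0 < \<delta>" and C: "0 < C" and \<tau>: "0 \<le> \<tau>"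
    and fm: "f \<in> borel_measurable sphere_measure"
    and f2: "integrable sphere_measure (\<lambda>\<omega>. (norm (f \<omega>))\<^sup>2)"
    and E: "E \<in> sets borel" "emeasure lborel E < \<infinity>"
    and large: "\<And>x. x \<in> E \<Longrightarrow> \<tau> \<le> norm (extension f x)"
  shows "\<tau>\<^sup>2 * measure lborel E \<le> (sphere_L2 f)\<^sup>2 *
    (C * \<delta> * measure lborel E + sphere_area TYPE('a) * unit_ball_vol (real DIM('a)) / \<delta> ^ (3 * DIM('a)))"
proof -
  define A where "A = sphere_area TYPE('a)"
  define m where "m = measure lborel E"
  define B where "B = C * \<delta> * m + A * unit_ball_vol (real DIM('a)) / \<delta> ^ (3 * DIM('a))"
  define h where "h = extension f"
  have [measurable]: "E \<in> sets borel" "h \<in> borel_measurable borel" "f \<in> borel_measurable sphere_measure"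
    using E extension_measurable[OF fm] fm by (auto simp: h_def)
  have A: "0 < A" unfolding A_def by (rule sphere_area_pos)
  have norm_sf: "norm (sphere_fourier (x::'a)) \<le> A" for x
    using norm_extension_le[of "\<lambda>_. 1" x] A sphere_area_pos[where 'a='a]
    by (simp add: A_def sphere_L2_def space_sphere_measure measure_sphere)
  define s where "s = (\<lambda>x. indicator E x *\<^sub>R cnj (sgn (h x)))"
  have sgn_le: "norm (sgn z) \<le> 1" for z :: complex
    by (simp add: norm_sgn)
  have [measurable]: "(\<lambda>x. cnj (sgn (h x))) \<in> borel_measurable borel"
  proof -
    have "(\<lambda>x. cnj (sgn (h x))) = (\<lambda>x. cnj (h x) / complex_of_real (norm (h x)))"
      by (simp add: sgn_eq)
    moreover have "(\<lambda>x. cnj (h x)) \<in> borel_measurable borel"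
      by (rule measurable_compose[OF _ cnj_measurable]) measurable
    ultimately show ?thesis by simp
  qed
  have s: "integrable lborel s"
    unfolding s_def
    by (rule integrableI_bounded_set_indicator[where B=1]) (use E sgn_le in auto)
  have indE: "integrable lborel (\<lambda>x. indicator E x :: real)"
    using E by (intro integrable_real_indicator) auto
  have norm_s: "norm (s x) \<le> indicator E x" for x
    using sgn_le by (auto simp: s_def indicator_def)
  have Ls: "(LINT x|lborel. norm (s x)) \<le> m"
    using integral_mono[OF integrable_norm[OF s] indE norm_s] by (simp add: m_def)
  have sB: "(LINT y|lborel. norm (s y) * norm (sphere_fourier (y - x))) \<le> B" for x
  proof -
    let ?c = "cball x (1 / \<delta> ^ 3)"
    have ind: "integrable lborel (\<lambda>y. indicator ?c y * A)"
      by (intro integrable_mult_left integrable_real_indicator emeasure_lborel_cball_finite) simp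
    have indE': "integrable lborel (\<lambda>y. indicator E y * (C * \<delta>))"
      by (intro integrable_mult_left indE)
    have "(LINT y|lborel. norm (s y) * norm (sphere_fourier (y - x)))
        \<le> (LINT y|lborel. indicator E y * (C * \<delta>) + indicator ?c y * A)"
    proof (rule integral_mono'[OF Bochner_Integration.integrable_add[OF indE' ind]])
      fix y
      show "norm (s y) * norm (sphere_fourier (y - x)) \<le> indicator E y * (C * \<delta>) + indicator ?c y * A"
      proof (cases "y \<in> ?c")
        case True
        have "norm (s y) * norm (sphere_fourier (y - x)) \<le> 1 * A"
          by (intro mult_mono norm_sf order_trans[OF norm_s]) (auto simp: indicator_def)
        also have "\<dots> \<le> indicator E y * (C * \<delta>) + indicator ?c y * A"
          using True C \<delta> by simp
        finally show ?thesis .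
      next
        case False
        hence "1 / \<delta> ^ 3 \<le> norm (y - x)"
          by (simp add: dist_norm norm_minus_commute)
        hence "norm (s y) * norm (sphere_fourier (y - x)) \<le> indicator E y * (C * \<delta>)"
          using norm_s[of y] C \<delta> by (intro mult_mono decay) auto
        thus ?thesis using False by simp
      qed
    qed (use C \<delta> A in auto)
    also have "\<dots> = m * (C * \<delta>) + measure lborel ?c * A"
      unfolding Bochner_Integration.integral_add[OF indE' ind] by (simp add: m_def)
    also have "\<dots> = B"
      using \<delta> by (simp add: B_def content_cball power_divide power_mult[symmetric])
    finally show ?thesis .
  qed
  have B0: "0 \<le> B"
    unfolding B_def m_def using C \<delta> A by simp
  have f: "integrable sphere_measure f"
    by (rule integrable_of_norm_sq[OF fm f2])
  have sm: "s \<in> borel_measurable borel" using s by simp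
  have four: "fourier s \<in> borel_measurable sphere_measure"
    by (rule fourier_measurable[OF sm])
  have four2: "integrable sphere_measure (\<lambda>\<omega>. (norm (fourier s \<omega>))\<^sup>2)"
    using four norm_fourier_le[of s]
    by (intro sphere.integrable_const_bound[where B="(LINT x|lborel. norm (s x))\<^sup>2"])
      (auto intro: power_mono)
  have "complex_of_real (LINT x|lborel. indicator E x * norm (h x)) = (LINT x|lborel. s x * h x)"
    unfolding integral_complex_of_real[symmetric]
  proof (intro Bochner_Integration.integral_cong refl)
    fix x
    have "cnj (sgn (h x)) * h x = complex_of_real (norm (h x))"
    proof (cases "h x = 0")
      case False
      have "cnj (sgn (h x)) * h x = (h x * cnj (h x)) / complex_of_real (norm (h x))"
        by (simp add: sgn_eq mult.commute)
      also have "h x * cnj (h x) = complex_of_real (norm (h x)) * complex_of_real (norm (h x))"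
        using complex_norm_square[of "h x"] by (simp add: power2_eq_square)
      finally show ?thesis using False by simp
    qed simp
    thus "complex_of_real (indicator E x * norm (h x)) = s x * h x"
      by (simp add: s_def indicator_def)
  qed
  hence eq: "\<bar>LINT x|lborel. indicator E x * norm (h x)\<bar> = norm (LINT x|lborel. s x * h x)"
    by (metis norm_of_real)
  have int_sh: "integrable lborel (\<lambda>x. s x * h x)"
    unfolding h_def by (rule integrable_mult_extension[OF s f])
  have int_Eh: "integrable lborel (\<lambda>x. indicator E x * norm (h x))"
  proof -
    have "norm (s x * h x) = indicator E x * norm (h x)" for x
      by (cases "h x = 0") (simp_all add: s_def norm_mult norm_sgn)
    thus ?thesis using integrable_norm[OF int_sh] by simp
  qed
  have "\<tau> * m = (LINT x|lborel. indicator E x * \<tau>)"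
    by (simp add: m_def)
  also have "\<dots> \<le> (LINT x|lborel. indicator E x * norm (h x))"
    using large by (intro integral_mono int_Eh integrable_mult_left indE)
      (auto simp: indicator_def h_def)
  also have "\<dots> \<le> norm (LINT x|lborel. s x * h x)"
    unfolding eq[symmetric] by simp
  also have "\<dots> = norm (LINT \<omega>|sphere_measure. f \<omega> * fourier s \<omega>)"
    unfolding h_def by (simp add: duality[OF s f])
  finally have "(\<tau> * m)\<^sup>2 \<le> (norm (LINT \<omega>|sphere_measure. f \<omega> * fourier s \<omega>))\<^sup>2"
    using \<tau> by (intro power_mono) (auto simp: m_def)
  also have "\<dots> \<le> (sphere_L2 f)\<^sup>2 * (LINT \<omega>|sphere_measure. (norm (fourier s \<omega>))\<^sup>2)"
    unfolding sphere_L2_sq by (rule Cauchy_Schwarz_integral[OF fm four f2 four2])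
  also have "\<dots> \<le> (sphere_L2 f)\<^sup>2 * (B * m)"
    using integral_norm_fourier_sq_le[OF s sB] mult_left_mono[OF Ls B0]
    by (intro mult_left_mono) auto
  finally have *: "m * (\<tau>\<^sup>2 * m) \<le> m * ((sphere_L2 f)\<^sup>2 * B)"
    by (simp add: power_mult_distrib power2_eq_square mult_ac)
  have "\<tau>\<^sup>2 * m \<le> (sphere_L2 f)\<^sup>2 * B"
  proof (cases "m = 0")
    case True
    thus ?thesis using B0 by simp
  next
    case False
    hence "0 < m" by (simp add: m_def measure_nonneg order_less_le)
    thus ?thesis using * by simp
  qed
  thus ?thesis by (simp add: B_def m_def A_def)
qed

text \<open>
  Choosing \<open>\<delta>\<close> so that \<open>F\<^sup>2 C \<delta> = \<tau>\<^sup>2 / 2\<close> absorbs the term proportional to \<open>\<bar>E\<bar>\<close> in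
  \<open>level_subset_bound\<close> into the left-hand side. Absorption needs \<open>\<bar>E\<bar> < \<infinity>\<close>, which is not known for
  the level set beforehand, hence the exhaustion by balls at the end.
\<close>

theorem extension_weak_type:
  assumes dim: "2 \<le> DIM('a::euclidean_space)"
  obtains K where "0 < K"
    and "\<And>(f :: 'a \<Rightarrow> complex) \<tau>. f \<in> borel_measurable sphere_measure \<Longrightarrow>
      integrable sphere_measure (\<lambda>\<omega>. (norm (f \<omega>))\<^sup>2) \<Longrightarrow> 0 < sphere_L2 f \<Longrightarrow> 0 < \<tau> \<Longrightarrow>
      emeasure lborel {x. \<tau> < norm (extension f x)} \<le>
        ennreal (K * (sphere_L2 f / \<tau>) ^ (6 * DIM('a) + 2))"
proof -
  obtain C where C: "0 < C"
    and decay: "\<And>\<delta> x::'a. 0 < \<delta> \<Longrightarrow> 1 / \<delta> ^ 3 \<le> norm x \<Longrightarrow> norm (sphere_fourier x) \<le> C * \<delta>"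
    using sphere_fourier_decay[OF dim] by blast
  define d where "d = DIM('a)"
  define A where "A = sphere_area TYPE('a) * unit_ball_vol (real DIM('a))"
  have A: "0 < A"
    using sphere_area_pos[where 'a='a] by (simp add: A_def)
  define K where "K = 2 * A * (2 * C) ^ (3 * d)"
  show ?thesis
  proof (rule that)
    show "0 < K" using A C by (simp add: K_def)
  next
    fix f :: "'a \<Rightarrow> complex" and \<tau> :: real
    assume fm: "f \<in> borel_measurable sphere_measure"
      and f2: "integrable sphere_measure (\<lambda>\<omega>. (norm (f \<omega>))\<^sup>2)"
      and F: "0 < sphere_L2 f" and \<tau>: "0 < \<tau>"
    define w where "w = sphere_L2 f / \<tau>"
    have w: "0 < w" using F \<tau> by (simp add: w_def)
    define \<delta> where "\<delta> = 1 / (2 * C * w\<^sup>2)"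
    have \<delta>: "0 < \<delta>" using C w by (simp add: \<delta>_def)
    have bound: "measure lborel E \<le> K * w ^ (6 * d + 2)"
      if E: "E \<in> sets borel" "emeasure lborel E < \<infinity>" "\<And>x. x \<in> E \<Longrightarrow> \<tau> \<le> norm (extension f x)" for E
    proof -
      define m where "m = measure lborel E"
      have "\<tau>\<^sup>2 * m \<le> (sphere_L2 f)\<^sup>2 * (C * \<delta> * m + A / \<delta> ^ (3 * d))"
        using level_subset_bound[OF decay[OF \<delta>] \<delta> C _ fm f2 E] \<tau> by (simp add: m_def A_def d_def)
      also have "sphere_L2 f = w * \<tau>"
        using \<tau> by (simp add: w_def)
      finally have "m \<le> w\<^sup>2 * (C * \<delta> * m + A / \<delta> ^ (3 * d))"
        using \<tau> by (simp add: power_mult_distrib mult_ac)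
      also have "\<dots> = (w\<^sup>2 * C * \<delta>) * m + w\<^sup>2 * A / \<delta> ^ (3 * d)"
        by (simp add: algebra_simps)
      also have "w\<^sup>2 * C * \<delta> = 1 / 2"
        using C w by (simp add: \<delta>_def)
      finally have "m \<le> 2 * w\<^sup>2 * A / \<delta> ^ (3 * d)"
        by simp
      also have "\<dots> = K * w ^ (6 * d + 2)"
      proof -
        have "w ^ (6 * d + 2) = (w\<^sup>2) ^ (3 * d) * w\<^sup>2"
          unfolding power_mult[symmetric] power_add[symmetric] by simp
        moreover have "1 / \<delta> ^ (3 * d) = (2 * C) ^ (3 * d) * (w\<^sup>2) ^ (3 * d)"
          by (simp only: \<delta>_def power_divide power_mult_distrib power_one) simp
        moreover have "2 * w\<^sup>2 * A / \<delta> ^ (3 * d) = 2 * w\<^sup>2 * A * (1 / \<delta> ^ (3 * d))"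
          by simp
        ultimately show ?thesis
          unfolding K_def by (simp only: mult_ac)
      qed
      finally show ?thesis by (simp add: m_def)
    qed
    let ?S = "{x. \<tau> < norm (extension f x)}"
    have [measurable]: "extension f \<in> borel_measurable borel"
      by (rule extension_measurable[OF fm])
    have S: "?S \<in> sets borel" by measurable
    define S where "S = (\<lambda>n::nat. ?S \<inter> cball 0 (real n))"
    have Sm: "S n \<in> sets borel" for n
      unfolding S_def by (intro sets.Int S) auto
    have Sf: "emeasure lborel (S n) < \<infinity>" for n
      by (rule le_less_trans[OF emeasure_mono emeasure_lborel_cball_finite[of 0 "real n"]])
        (auto simp: S_def)
    have "emeasure lborel (S n) \<le> ennreal (K * w ^ (6 * d + 2))" for n
    proof -
      have "measure lborel (S n) \<le> K * w ^ (6 * d + 2)"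
        by (rule bound[OF Sm Sf]) (auto simp: S_def)
      moreover have "emeasure lborel (S n) = ennreal (measure lborel (S n))"
        using Sf[of n] by (intro emeasure_eq_ennreal_measure) auto
      ultimately show ?thesis by (simp add: ennreal_leI)
    qed
    moreover have "(\<lambda>n. emeasure lborel (S n)) \<longlonglongrightarrow> emeasure lborel (\<Union>n. S n)"
      using Sm by (intro Lim_emeasure_incseq) (auto simp: S_def incseq_def)
    ultimately have "emeasure lborel (\<Union>n. S n) \<le> ennreal (K * w ^ (6 * d + 2))"
      by (intro LIMSEQ_le_const2) auto
    also have "(\<Union>n. S n) = ?S"
      by (auto simp: S_def intro: real_arch_simple)
    finally show "emeasure lborel ?S \<le> ennreal (K * (sphere_L2 f / \<tau>) ^ (6 * DIM('a) + 2))"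
      by (simp add: w_def d_def)
  qed
qed

text \<open>
  Dyadic interpolation between weak type \<open>m\<close> and \<open>L\<^sup>\<infinity>\<close>: where \<open>2 ^ (- k - 1) < g \<le> 2 ^ (- k)\<close>, the
  integrand is at most \<open>2 ^ (- k (m + 1))\<close>, while the set where the lower bound holds has measure at
  most \<open>K 2 ^ ((k + 1) m)\<close>. The products form a geometric series. The bound does not depend on \<open>q\<close>,
  because raising the exponent only decreases powers of numbers in \<open>[0, 1]\<close>.
\<close>

lemma nn_integral_powr_le_of_weak_type:
  fixes g :: "'b \<Rightarrow> real"
  assumes [measurable]: "g \<in> borel_measurable M"
    and g: "\<And>x. 0 \<le> g x" "\<And>x. g x \<le> 1" and K: "0 \<le> K"
    and weak: "\<And>\<tau>. 0 < \<tau> \<Longrightarrow> emeasure M {x \<in> space M. \<tau> < g x} \<le> ennreal (K * (1 / \<tau>) ^ m)"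
    and q: "real m + 1 \<le> q"
  shows "(\<integral>\<^sup>+x. ennreal (g x powr q) \<partial>M) \<le> ennreal (K * 2 ^ (m + 1))"
proof -
  define c where "c = (\<lambda>k::nat. (1 / 2 :: real) ^ (k * (m + 1)))"
  define L where "L = (\<lambda>k::nat. {x \<in> space M. (1 / 2) ^ (k + 1) < g x})"
  have [measurable]: "L k \<in> sets M" for k
    unfolding L_def by measurable
  have pointwise: "ennreal (g x powr q) \<le> (\<Sum>k. ennreal (c k) * indicator (L k) x)" if x: "x \<in> space M" for x
  proof (cases "g x = 0")
    case False
    hence pos: "0 < g x" using g(1)[of x] by simp
    define n where "n = (LEAST n. (1 / 2) ^ n < g x)"
    have ex: "\<exists>n. (1 / 2) ^ n < g x"
      using real_arch_pow_inv[OF pos, of "1/2"] by simp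
    have n: "(1 / 2) ^ n < g x"
      unfolding n_def by (rule LeastI_ex[OF ex])
    have "n \<noteq> 0" using n g(2)[of x] by (intro notI) auto
    then obtain k where k: "n = Suc k" by (cases n) auto
    have "\<not> (1 / 2) ^ k < g x"
      using not_less_Least[of k "\<lambda>n. (1 / 2) ^ n < g x"] k by (simp add: n_def)
    hence le: "g x \<le> (1 / 2) ^ k" by simp
    have "g x powr q \<le> g x powr real (m + 1)"
      using q pos g(2)[of x] by (intro powr_mono') auto
    also have "\<dots> = g x ^ (m + 1)"
      using pos by (rule powr_realpow)
    also have "\<dots> \<le> ((1 / 2) ^ k) ^ (m + 1)"
      using le g(1)[of x] by (rule power_mono)
    also have "\<dots> = c k"
      by (simp only: c_def power_mult)
    finally have "ennreal (g x powr q) \<le> ennreal (c k) * indicator (L k) x"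
      using n k x by (simp add: L_def ennreal_leI)
    also have "\<dots> \<le> (\<Sum>k. ennreal (c k) * indicator (L k) x)"
    proof -
      have "sum f {k} \<le> suminf f" for f :: "nat \<Rightarrow> ennreal"
        by (intro sum_le_suminf) auto
      thus ?thesis unfolding sum.insert_if sum.empty by fastforce
    qed
    finally show ?thesis .
  qed simp
  have "(\<integral>\<^sup>+x. ennreal (g x powr q) \<partial>M) \<le> (\<integral>\<^sup>+x. (\<Sum>k. ennreal (c k) * indicator (L k) x) \<partial>M)"
    by (rule nn_integral_mono) (rule pointwise)
  also have "\<dots> = (\<Sum>k. \<integral>\<^sup>+x. ennreal (c k) * indicator (L k) x \<partial>M)"
    by (rule nn_integral_suminf) measurable
  also have "\<dots> = (\<Sum>k. ennreal (c k) * emeasure M (L k))"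
    by (simp add: nn_integral_cmult_indicator)
  also have "\<dots> \<le> (\<Sum>k. ennreal (K * 2 ^ m * (1 / 2) ^ k))"
  proof (rule suminf_le)
    fix k
    have "ennreal (c k) * emeasure M (L k) \<le> ennreal (c k) * ennreal (K * (1 / (1 / 2) ^ (k + 1)) ^ m)"
      unfolding L_def by (intro mult_left_mono weak) auto
    also have "\<dots> = ennreal (c k * (K * (1 / (1 / 2) ^ (k + 1)) ^ m))"
      using K by (subst ennreal_mult) (auto simp: c_def)
    also have "c k * (K * (1 / (1 / 2) ^ (k + 1)) ^ m) = K * 2 ^ m * (1 / 2) ^ k"
      by (simp add: c_def power_divide power_add power_mult_distrib power_mult[symmetric] field_simps)
    finally show "ennreal (c k) * emeasure M (L k) \<le> ennreal (K * 2 ^ m * (1 / 2) ^ k)" .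
  qed auto
  also have "\<dots> = ennreal (\<Sum>k. K * 2 ^ m * (1 / 2) ^ k)"
    using K by (intro suminf_ennreal2 summable_mult summable_geometric) auto
  also have "(\<Sum>k. K * 2 ^ m * (1 / 2) ^ k) = K * 2 ^ m * (\<Sum>k. (1 / 2 :: real) ^ k)"
    by (rule suminf_mult) (simp add: summable_geometric)
  also have "\<dots> = K * 2 ^ (m + 1)"
    by (simp add: suminf_geometric)
  finally show ?thesis .
qed

section \<open>The optimal constants\<close>

lemma Lq_norm_eq:
  assumes "0 < q" and I: "(\<integral>\<^sup>+x. ennreal (norm (f x) powr q) \<partial>M) \<noteq> \<infinity>"
  shows "Lq_norm M (ennreal q) f =
    ennreal (enn2real (\<integral>\<^sup>+x. ennreal (norm (f x) powr q) \<partial>M) powr (1 / q))"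
  using assms by (simp add: Lq_norm_def)

lemma Lq_norm_le:
  assumes q: "0 < q" and a: "0 \<le> a"
    and I: "(\<integral>\<^sup>+x. ennreal (norm (f x) powr q) \<partial>M) \<le> ennreal a"
  shows "Lq_norm M (ennreal q) f \<le> ennreal (a powr (1 / q))"
proof -
  have "(\<integral>\<^sup>+x. ennreal (norm (f x) powr q) \<partial>M) \<noteq> \<infinity>"
    using I by (auto simp: top_unique)
  moreover have "enn2real (\<integral>\<^sup>+x. ennreal (norm (f x) powr q) \<partial>M) \<le> a"
    using I a by (rule enn2real_leI[rotated])
  ultimately show ?thesis
    using q by (subst Lq_norm_eq) (auto intro!: ennreal_leI powr_mono2)
qed

lemma Lq_norm_ge:
  assumes q: "0 < q" and a: "0 \<le> a"
    and I: "ennreal a \<le> (\<integral>\<^sup>+x. ennreal (norm (f x) powr q) \<partial>M)"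
  shows "ennreal (a powr (1 / q)) \<le> Lq_norm M (ennreal q) f"
proof (cases "(\<integral>\<^sup>+x. ennreal (norm (f x) powr q) \<partial>M) = \<infinity>")
  case True
  thus ?thesis using q by (simp add: Lq_norm_def)
next
  case False
  hence "a \<le> enn2real (\<integral>\<^sup>+x. ennreal (norm (f x) powr q) \<partial>M)"
    using enn2real_mono[OF I] a by (simp add: less_top)
  thus ?thesis
    using q a False by (subst Lq_norm_eq) (auto intro!: ennreal_leI powr_mono2)
qed

lemma Lq_norm_2_sphere:
  assumes "integrable sphere_measure (\<lambda>\<omega>. (norm (f \<omega>))\<^sup>2)"
  shows "Lq_norm sphere_measure 2 f = ennreal (sphere_L2 f)"
proof -
  have powr2: "norm (f \<omega>) powr 2 = (norm (f \<omega>))\<^sup>2" for \<omega>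
    by (simp add: powr_numeral)
  have "(\<integral>\<^sup>+\<omega>. ennreal (norm (f \<omega>) powr 2) \<partial>sphere_measure)
      = ennreal (LINT \<omega>|sphere_measure. (norm (f \<omega>))\<^sup>2)"
    unfolding powr2 using assms by (rule nn_integral_eq_integral) simp
  hence "Lq_norm sphere_measure (ennreal 2) f
      = ennreal ((LINT \<omega>|sphere_measure. (norm (f \<omega>))\<^sup>2) powr (1 / 2))"
    by (subst Lq_norm_eq) simp_all
  thus ?thesis
    by (simp add: sphere_L2_def powr_half_sqrt)
qed

lemma L2_sphere_iff:
  "f \<in> L2_sphere \<longleftrightarrow> f \<in> borel_measurable sphere_measure \<and>
     integrable sphere_measure (\<lambda>\<omega>. (norm (f \<omega>))\<^sup>2)"
proof (intro iffI conjI)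
  assume f: "f \<in> L2_sphere"
  thus fm [measurable]: "f \<in> borel_measurable sphere_measure"
    by (simp add: L2_sphere_def)
  have "Lq_norm sphere_measure 2 f < \<infinity>"
    using f by (simp add: L2_sphere_def)
  hence "(\<integral>\<^sup>+\<omega>. ennreal (norm (f \<omega>) powr 2) \<partial>sphere_measure) < \<infinity>"
    by (auto simp: Lq_norm_def Let_def less_top split: if_splits)
  thus "integrable sphere_measure (\<lambda>\<omega>. (norm (f \<omega>))\<^sup>2)"
    by (intro integrableI_bounded) (simp_all add: powr_numeral)
next
  assume "f \<in> borel_measurable sphere_measure \<and> integrable sphere_measure (\<lambda>\<omega>. (norm (f \<omega>))\<^sup>2)"
  thus "f \<in> L2_sphere"
    by (simp add: L2_sphere_def Lq_norm_2_sphere)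
qed

lemma sphere_L2_pos:
  assumes f: "f \<in> L2_sphere" and nz: "\<not> (AE \<omega> in sphere_measure. f \<omega> = 0)"
  shows "0 < sphere_L2 f"
proof -
  have f2: "integrable sphere_measure (\<lambda>\<omega>. (norm (f \<omega>))\<^sup>2)"
    using f by (simp add: L2_sphere_iff)
  have "(LINT \<omega>|sphere_measure. (norm (f \<omega>))\<^sup>2) \<noteq> 0"
    using nz integral_nonneg_eq_0_iff_AE[OF f2] by auto
  moreover have "0 \<le> (LINT \<omega>|sphere_measure. (norm (f \<omega>))\<^sup>2)"
    by simp
  ultimately have "0 < (LINT \<omega>|sphere_measure. (norm (f \<omega>))\<^sup>2)"
    by linarith
  thus ?thesis
    by (simp add: sphere_L2_def)
qed

lemma extension_const_le:
  assumes "\<And>f :: 'a::euclidean_space \<Rightarrow> complex. f \<in> borel_measurable sphere_measure \<Longrightarrow>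
      integrable sphere_measure (\<lambda>\<omega>. (norm (f \<omega>))\<^sup>2) \<Longrightarrow> 0 < sphere_L2 f \<Longrightarrow>
      Lq_norm lborel q (extension f) \<le> ennreal (c * sphere_L2 f)"
    and c: "0 \<le> c"
  shows "extension_const TYPE('a) q \<le> ennreal c"
  unfolding extension_const_def
proof (rule SUP_least)
  fix f :: "'a \<Rightarrow> complex"
  assume f: "f \<in> {f. f \<in> L2_sphere \<and> \<not> (AE \<omega> in sphere_measure. f \<omega> = 0)}"
  hence F: "0 < sphere_L2 f"
    using sphere_L2_pos by blast
  have f': "f \<in> borel_measurable sphere_measure" "integrable sphere_measure (\<lambda>\<omega>. (norm (f \<omega>))\<^sup>2)"
    using f by (auto simp: L2_sphere_iff)
  have "Lq_norm lborel q (extension f) / Lq_norm sphere_measure 2 f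
      \<le> ennreal (c * sphere_L2 f) / ennreal (sphere_L2 f)"
    unfolding Lq_norm_2_sphere[OF f'(2)]
    by (rule divide_right_mono_ennreal) (rule assms(1)[OF f' F])
  also have "\<dots> = ennreal c"
    using F c by (simp add: divide_ennreal)
  finally show "Lq_norm lborel q (extension f) / Lq_norm sphere_measure 2 f \<le> ennreal c" .
qed

lemma sphere_L2_one:
  "sphere_L2 (\<lambda>_::'a::euclidean_space. 1) = sqrt (sphere_area TYPE('a))"
  by (simp add: sphere_L2_def space_sphere_measure measure_sphere)

text \<open>
  The constant function \<open>1\<close> is an extremiser at \<open>q = \<infinity>\<close>, and it serves as the test function at every \<open>q\<close>.
\<close>

lemma extension_const_ge:
  assumes le: "ennreal (c * sphere_area TYPE('a::euclidean_space)) \<le> Lq_norm lborel q (sphere_fourier :: 'a \<Rightarrow> complex)"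
    and c: "0 \<le> c"
  shows "ennreal (c * sqrt (sphere_area TYPE('a))) \<le> extension_const TYPE('a) q"
proof -
  let ?A = "sphere_area TYPE('a)"
  let ?one = "(\<lambda>_::'a. 1 :: complex)"
  have A: "0 < ?A" by (rule sphere_area_pos)
  have int: "integrable sphere_measure (\<lambda>\<omega>. (norm (?one \<omega>))\<^sup>2)"
    by simp
  have nz: "\<not> (AE \<omega> in sphere_measure. ?one \<omega> = 0)"
  proof
    assume "AE \<omega> in sphere_measure. ?one \<omega> = 0"
    hence "(LINT \<omega>|sphere_measure. ?one \<omega>) = (LINT \<omega>|(sphere_measure :: 'a measure). 0)"
      by (intro integral_cong_AE) auto
    thus False
      using A by (simp add: space_sphere_measure measure_sphere)
  qed
  have "c * sqrt ?A = c * ?A / sqrt ?A"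
    using A by (simp add: real_div_sqrt times_divide_eq_right[symmetric] del: times_divide_eq_right)
  hence "ennreal (c * sqrt ?A) = ennreal (c * ?A) / ennreal (sqrt ?A)"
    using A c by (subst divide_ennreal) auto
  also have "\<dots> \<le> Lq_norm lborel q (sphere_fourier :: 'a \<Rightarrow> complex) / Lq_norm sphere_measure 2 ?one"
    unfolding Lq_norm_2_sphere[OF int] sphere_L2_one
    by (rule divide_right_mono_ennreal) (rule le)
  also have "\<dots> \<le> extension_const TYPE('a) q"
    unfolding extension_const_def using int nz by (intro SUP_upper) (simp add: L2_sphere_iff)
  finally show ?thesis .
qed

lemma norm_sphere_fourier_ge:
  fixes x :: "'a::euclidean_space"
  shows "sphere_area TYPE('a) * (1 - norm x) \<le> norm (sphere_fourier x)"
proof -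
  let ?A = "sphere_area TYPE('a)"
  have ph: "integrable sphere_measure (\<lambda>\<omega>. phase (x \<bullet> \<omega>))"
    by (rule integrable_sphere_bounded[where B=1]) auto
  have "complex_of_real ?A - sphere_fourier x = (LINT \<omega>|sphere_measure. 1 - phase (x \<bullet> \<omega>))"
    unfolding extension_def using ph
    by (simp add: Bochner_Integration.integral_diff space_sphere_measure measure_sphere scaleR_conv_of_real)
  also have "norm \<dots> \<le> (LINT \<omega>|sphere_measure. norm (1 - phase (x \<bullet> \<omega>)))"
    by (rule integral_norm_bound)
  also have "\<dots> \<le> (LINT \<omega>|(sphere_measure :: 'a measure). norm x)"
  proof (rule integral_mono)
    show "integrable sphere_measure (\<lambda>\<omega>. norm (1 - phase (x \<bullet> \<omega>)))"
      using ph by (intro integrable_norm Bochner_Integration.integrable_diff) auto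
    fix \<omega> :: 'a assume "\<omega> \<in> space sphere_measure"
    hence \<omega>: "norm \<omega> = 1" by (simp add: space_sphere_measure)
    have "norm (1 - phase (x \<bullet> \<omega>)) = norm (exp (\<i> * complex_of_real (- (x \<bullet> \<omega>))) - 1)"
      by (simp add: norm_minus_commute)
    also have "\<dots> \<le> \<bar>x \<bullet> \<omega>\<bar>"
      unfolding dist_exp_i_1 using abs_sin_x_le_abs_x[of "- (x \<bullet> \<omega>) / 2"] by simp
    also have "\<dots> \<le> norm x"
      using Cauchy_Schwarz_ineq2[of x \<omega>] \<omega> by simp
    finally show "norm (1 - phase (x \<bullet> \<omega>)) \<le> norm x" .
  qed simp
  also have "\<dots> = norm x * ?A"
    by (simp add: space_sphere_measure measure_sphere mult.commute)
  finally have "norm (complex_of_real ?A - sphere_fourier x) \<le> norm x * ?A" .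
  moreover have "norm (complex_of_real ?A) - norm (sphere_fourier x) \<le> norm (complex_of_real ?A - sphere_fourier x)"
    by (rule norm_triangle_ineq2)
  moreover have "norm (complex_of_real ?A) = ?A"
    using sphere_area_pos[where 'a='a] by simp
  ultimately show ?thesis
    by (simp add: algebra_simps)
qed

text \<open>
  The essential supremum of the extension of \<open>1\<close> is its value \<open>A\<close> at the origin: a smaller bound \<open>b\<close>
  holding almost everywhere would fail on the whole ball of radius \<open>1 - b / A\<close>.
\<close>

lemma extension_const_infinity:
  "extension_const TYPE('a::euclidean_space) \<infinity> = ennreal (sqrt (sphere_area TYPE('a)))"
proof (rule antisym)
  let ?A = "sphere_area TYPE('a)"
  have A: "0 < ?A" by (rule sphere_area_pos)
  show "extension_const TYPE('a) \<infinity> \<le> ennreal (sqrt ?A)"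
  proof (rule extension_const_le)
    fix f :: "'a \<Rightarrow> complex"
    assume f: "f \<in> borel_measurable sphere_measure" "integrable sphere_measure (\<lambda>\<omega>. (norm (f \<omega>))\<^sup>2)"
    have [measurable]: "extension f \<in> borel_measurable borel"
      by (rule extension_measurable[OF f(1)])
    show "Lq_norm lborel \<infinity> (extension f) \<le> ennreal (sqrt ?A * sphere_L2 f)"
      using norm_extension_le[OF f] by (auto simp: Lq_norm_def intro!: esssup_I ennreal_leI)
  qed (use A in simp)
  show "ennreal (sqrt ?A) \<le> extension_const TYPE('a) \<infinity>"
  proof -
    have "ennreal (1 * ?A) \<le> Lq_norm lborel \<infinity> (sphere_fourier :: 'a \<Rightarrow> complex)"
    proof (rule ccontr)
      assume "\<not> ?thesis"
      then have less: "esssup lborel (\<lambda>x::'a. ennreal (norm (sphere_fourier x))) < ennreal ?A"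
        by (simp add: Lq_norm_def not_le)
      then obtain b where b: "esssup lborel (\<lambda>x::'a. ennreal (norm (sphere_fourier x))) = ennreal b" "0 \<le> b"
        by (cases "esssup lborel (\<lambda>x::'a. ennreal (norm (sphere_fourier x)))") auto
      have bA: "b < ?A" using less b by (simp add: ennreal_less_iff)
      define r where "r = 1 - b / ?A"
      have r: "0 < r" using bA A by (simp add: r_def field_simps)
      have "AE x::'a in lborel. ennreal (norm (sphere_fourier x)) \<le> ennreal b"
        unfolding b(1)[symmetric] by (rule esssup_AE)
      hence "AE x::'a in lborel. x \<notin> ball 0 r"
      proof eventually_elim
        case (elim x)
        have "norm (sphere_fourier x) \<le> b" using elim b(2) by (simp add: ennreal_le_iff)
        hence "?A * (1 - norm x) \<le> b"
          using norm_sphere_fourier_ge[of x] by linarith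
        thus ?case using A by (simp add: r_def field_simps not_less)
      qed
      hence "emeasure lborel (ball (0::'a) r) = 0"
        by (subst (asm) AE_iff_measurable[where N="ball 0 r"]) auto
      hence "ennreal (unit_ball_vol (real DIM('a)) * r ^ DIM('a)) = 0"
        using r by (simp add: emeasure_ball)
      hence "unit_ball_vol (real DIM('a)) * r ^ DIM('a) \<le> 0"
        by (simp only: ennreal_eq_0_iff)
      moreover have "0 < unit_ball_vol (real DIM('a)) * r ^ DIM('a)"
        using r by (intro mult_pos_pos unit_ball_vol_pos) auto
      ultimately show False
        by linarith
    qed
    from extension_const_ge[OF this] show ?thesis
      by simp
  qed
qed

lemma Lq_norm_sphere_fourier_ge:
  assumes q: "0 < q" and r: "0 < r" "r < 1"
  shows "ennreal ((1 - r) * (unit_ball_vol (real DIM('a)) * r ^ DIM('a)) powr (1 / q) * sphere_area TYPE('a))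
    \<le> Lq_norm lborel (ennreal q) (sphere_fourier :: 'a::euclidean_space \<Rightarrow> complex)"
proof -
  let ?A = "sphere_area TYPE('a)"
  define v where "v = unit_ball_vol (real DIM('a)) * r ^ DIM('a)"
  have v: "0 < v" using r by (simp add: v_def)
  define a where "a = (?A * (1 - r)) powr q * v"
  have A: "0 < ?A" by (rule sphere_area_pos)
  have "ennreal a = (\<integral>\<^sup>+(x::'a). ennreal ((?A * (1 - r)) powr q) * indicator (cball 0 r) x \<partial>lborel)"
    using r v by (simp add: nn_integral_cmult_indicator emeasure_cball a_def v_def ennreal_mult)
  also have "\<dots> \<le> (\<integral>\<^sup>+(x::'a). ennreal (norm (sphere_fourier x) powr q) \<partial>lborel)"
  proof (rule nn_integral_mono)
    fix x :: 'a
    have "(?A * (1 - r)) powr q \<le> norm (sphere_fourier x) powr q" if "norm x \<le> r"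
    proof (rule powr_mono2)
      have "?A * (1 - r) \<le> ?A * (1 - norm x)"
        using that A by (intro mult_left_mono) auto
      thus "?A * (1 - r) \<le> norm (sphere_fourier x)"
        using norm_sphere_fourier_ge[of x] by linarith
    qed (use q r A in auto)
    thus "ennreal ((?A * (1 - r)) powr q) * indicator (cball 0 r) x
        \<le> ennreal (norm (sphere_fourier x) powr q)"
      by (auto simp: indicator_def intro!: ennreal_leI)
  qed
  finally have "ennreal (a powr (1 / q)) \<le> Lq_norm lborel (ennreal q) (sphere_fourier :: 'a \<Rightarrow> complex)"
    using q v by (intro Lq_norm_ge) (auto simp: a_def)
  also have "a powr (1 / q) = (1 - r) * v powr (1 / q) * ?A"
    using q r v A by (simp add: a_def powr_mult powr_powr)
  finally show ?thesis by (simp add: v_def)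
qed

text \<open>
  Weak type is applied to the extension of \<open>f\<close> divided by its uniform bound \<open>N = \<surd>A F\<close>. After this
  normalisation \<open>f\<close> disappears from the estimates, and \<open>K\<close> enters only through its \<open>1/q\<close>-th power.
\<close>

lemma extension_const_upper:
  assumes dim: "2 \<le> DIM('a::euclidean_space)"
  obtains K q\<^sub>0 where "0 < K"
    and "\<And>q. q\<^sub>0 \<le> q \<Longrightarrow> extension_const TYPE('a) (ennreal q) \<le> ennreal (sqrt (sphere_area TYPE('a)) * K powr (1 / q))"
proof -
  let ?A = "sphere_area TYPE('a)"
  have A: "0 < ?A" by (rule sphere_area_pos)
  define m where "m = 6 * DIM('a) + 2"
  obtain K\<^sub>0 where K\<^sub>0: "0 < K\<^sub>0"
    and weak: "\<And>(f :: 'a \<Rightarrow> complex) \<tau>. f \<in> borel_measurable sphere_measure \<Longrightarrow>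
      integrable sphere_measure (\<lambda>\<omega>. (norm (f \<omega>))\<^sup>2) \<Longrightarrow> 0 < sphere_L2 f \<Longrightarrow> 0 < \<tau> \<Longrightarrow>
      emeasure lborel {x. \<tau> < norm (extension f x)} \<le> ennreal (K\<^sub>0 * (sphere_L2 f / \<tau>) ^ m)"
    unfolding m_def by (rule extension_weak_type[OF dim]) blast
  define K\<^sub>1 where "K\<^sub>1 = K\<^sub>0 / sqrt ?A ^ m"
  have K\<^sub>1: "0 < K\<^sub>1" using K\<^sub>0 A by (simp add: K\<^sub>1_def)
  define K where "K = K\<^sub>1 * 2 ^ (m + 1)"
  have K: "0 < K" using K\<^sub>1 by (simp add: K_def)
  have "extension_const TYPE('a) (ennreal q) \<le> ennreal (sqrt ?A * K powr (1 / q))"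
    if q: "real m + 1 \<le> q" for q
  proof (rule extension_const_le)
    fix f :: "'a \<Rightarrow> complex"
    assume f: "f \<in> borel_measurable sphere_measure" "integrable sphere_measure (\<lambda>\<omega>. (norm (f \<omega>))\<^sup>2)"
      and F: "0 < sphere_L2 f"
    define N where "N = sqrt ?A * sphere_L2 f"
    have N: "0 < N" using A F by (simp add: N_def)
    have q0: "0 < q" using q by linarith
    have [measurable]: "extension f \<in> borel_measurable borel"
      by (rule extension_measurable[OF f(1)])
    define g where "g = (\<lambda>x. norm (extension f x) / N)"
    have [measurable]: "g \<in> borel_measurable lborel"
      unfolding g_def by measurable
    have "(\<integral>\<^sup>+x. ennreal (g x powr q) \<partial>lborel) \<le> ennreal (K\<^sub>1 * 2 ^ (m + 1))"
    proof (rule nn_integral_powr_le_of_weak_type)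
      show "0 \<le> g x" for x using N by (simp add: g_def)
      show "g x \<le> 1" for x
        using norm_extension_le[OF f, of x] N by (simp add: g_def N_def)
      show "0 \<le> K\<^sub>1" using K\<^sub>1 by simp
      show "emeasure lborel {x \<in> space lborel. \<tau> < g x} \<le> ennreal (K\<^sub>1 * (1 / \<tau>) ^ m)" if "0 < \<tau>" for \<tau>
      proof -
        have "{x \<in> space lborel. \<tau> < g x} = {x. \<tau> * N < norm (extension f x)}"
          using N by (auto simp: g_def field_simps)
        moreover have "K\<^sub>0 * (sphere_L2 f / (\<tau> * N)) ^ m = K\<^sub>1 * (1 / \<tau>) ^ m"
          using F A that by (simp add: N_def K\<^sub>1_def power_divide power_mult_distrib)
        ultimately show ?thesis
          using weak[OF f F, of "\<tau> * N"] that N by simp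
      qed
    qed (use q in auto)
    hence g_le: "(\<integral>\<^sup>+x. ennreal (g x powr q) \<partial>lborel) \<le> ennreal K"
      by (simp add: K_def)
    have "(\<integral>\<^sup>+x. ennreal (norm (extension f x) powr q) \<partial>lborel)
        = (\<integral>\<^sup>+x. ennreal (N powr q) * ennreal (g x powr q) \<partial>lborel)"
      using N by (intro nn_integral_cong) (simp add: g_def powr_divide ennreal_mult[symmetric])
    also have "\<dots> = ennreal (N powr q) * (\<integral>\<^sup>+x. ennreal (g x powr q) \<partial>lborel)"
      by (rule nn_integral_cmult) measurable
    also have "\<dots> \<le> ennreal (N powr q) * ennreal K"
      using g_le by (rule mult_left_mono) simp
    also have "\<dots> = ennreal (N powr q * K)"
      using K by (simp add: ennreal_mult)
    finally have "Lq_norm lborel (ennreal q) (extension f) \<le> ennreal ((N powr q * K) powr (1 / q))"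
      using q0 K by (intro Lq_norm_le) auto
    also have "(N powr q * K) powr (1 / q) = N * K powr (1 / q)"
      using q0 K N by (simp add: powr_mult powr_powr)
    also have "\<dots> = sqrt ?A * K powr (1 / q) * sphere_L2 f"
      by (simp add: N_def)
    finally show "Lq_norm lborel (ennreal q) (extension f)
      \<le> ennreal (sqrt ?A * K powr (1 / q) * sphere_L2 f)" .
  qed (use A in auto)
  thus ?thesis by (rule that[OF K])
qed

lemma powr_inverse_tendsto_1:
  assumes "0 < (a::real)"
  shows "((\<lambda>q. a powr (1 / q)) \<longlongrightarrow> 1) at_top"
proof -
  have "((\<lambda>q::real. a powr (1 / q)) \<longlongrightarrow> a powr 0) at_top"
    using assms by (intro tendsto_powr tendsto_const tendsto_divide_0[OF tendsto_const])
      (auto intro: filterlim_at_top_imp_at_infinity filterlim_ident)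
  thus ?thesis using assms by simp
qed

theorem extension_const_tendsto:
  assumes dim: "2 \<le> DIM('a::euclidean_space)"
  shows "((\<lambda>q::real. extension_const TYPE('a) (ennreal q)) \<longlongrightarrow> extension_const TYPE('a) \<infinity>) at_top"
  unfolding extension_const_infinity
proof (rule order_tendstoI)
  let ?A = "sphere_area TYPE('a)"
  have A: "0 < ?A" by (rule sphere_area_pos)
  {
    fix b :: ennreal
    assume b: "ennreal (sqrt ?A) < b"
    obtain K q\<^sub>0 where K: "0 < K"
      and upper: "\<And>q. q\<^sub>0 \<le> q \<Longrightarrow> extension_const TYPE('a) (ennreal q) \<le> ennreal (sqrt ?A * K powr (1 / q))"
      using extension_const_upper[OF dim] by blast
    have "((\<lambda>q. ennreal (sqrt ?A * K powr (1 / q))) \<longlongrightarrow> ennreal (sqrt ?A * 1)) at_top"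
      by (intro tendsto_ennrealI tendsto_mult tendsto_const powr_inverse_tendsto_1 K)
    hence "\<forall>\<^sub>F q in at_top. ennreal (sqrt ?A * K powr (1 / q)) < b"
      using b by (intro order_tendstoD) auto
    thus "\<forall>\<^sub>F q in at_top. extension_const TYPE('a) (ennreal q) < b"
      using eventually_ge_at_top[of q\<^sub>0]
      by eventually_elim (use upper in \<open>blast intro: le_less_trans\<close>)
  next
    fix b :: ennreal
    assume b: "b < ennreal (sqrt ?A)"
    then obtain c where c: "b = ennreal c" "0 \<le> c"
      by (cases b) auto
    define S where "S = sqrt ?A"
    have S: "0 < S" using A by (simp add: S_def)
    have cS: "c < S" using b c A by (simp add: S_def ennreal_less_iff)
    \<comment> \<open>Half of the relative gap between \<open>c\<close> and \<open>S\<close>, so that \<open>(1 - r) S\<close> is their midpoint.\<close>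
    define r where "r = (1 - c / S) / 2"
    have r: "0 < r" "r < 1"
      using cS c(2) S by (auto simp: r_def field_simps)
    have half: "(1 - r) * 1 * S = (S + c) / 2"
      using S by (simp add: r_def field_simps)
    have "c < (S + c) / 2" using cS by simp
    hence cr: "c < (1 - r) * 1 * sqrt ?A"
      unfolding half[unfolded S_def] S_def .
    define v where "v = unit_ball_vol (real DIM('a)) * r ^ DIM('a)"
    have v: "0 < v" using r by (simp add: v_def)
    have "((\<lambda>q. (1 - r) * v powr (1 / q) * sqrt ?A) \<longlongrightarrow> (1 - r) * 1 * sqrt ?A) at_top"
      by (intro tendsto_mult tendsto_const powr_inverse_tendsto_1 v)
    hence "\<forall>\<^sub>F q in at_top. c < (1 - r) * v powr (1 / q) * sqrt ?A"
      using cr by (rule order_tendstoD)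
    thus "\<forall>\<^sub>F q in at_top. b < extension_const TYPE('a) (ennreal q)"
      using eventually_gt_at_top[of 0]
    proof eventually_elim
      case (elim q)
      have "b < ennreal ((1 - r) * v powr (1 / q) * sqrt ?A)"
        using elim c by (simp add: ennreal_less_iff)
      also have "\<dots> \<le> extension_const TYPE('a) (ennreal q)"
        using Lq_norm_sphere_fourier_ge[OF elim(2) r, where 'a='a] r
        by (intro extension_const_ge) (auto simp: v_def)
      finally show ?case .
    qed
  }
qed

lemma sphere_area_eq:
  "sphere_area TYPE('a::euclidean_space) = 2 * pi powr (real DIM('a) / 2) / Gamma (real DIM('a) / 2)"
proof -
  define d where "d = real DIM('a)"
  have d: "0 < d" by (simp add: d_def)
  have "Gamma (d / 2 + 1) = d / 2 * Gamma (d / 2)"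
    using d by (intro Gamma_plus1) (auto elim!: nonpos_Ints_cases)
  moreover have "sphere_area TYPE('a) = d * (pi powr (d / 2) / Gamma (d / 2 + 1))"
    by (simp add: sphere_area_def unit_ball_vol_def d_def)
  ultimately have "sphere_area TYPE('a) = d * (pi powr (d / 2) / (d / 2 * Gamma (d / 2)))"
    by (simp only:)
  thus ?thesis
    using d by (simp add: d_def[symmetric])
qed

theorem theorem1p6:
  fixes d :: nat
  assumes "CARD('n::finite) = d" and "d \<in> {3, 4, 5, 6, 7}"
  shows "((\<lambda>q::real. extension_const TYPE(real ^ 'n) (ennreal q))
            \<longlongrightarrow> extension_const TYPE(real ^ 'n) \<infinity>) at_top
       \<and> extension_const TYPE(real ^ 'n) \<infinity>
            = ennreal ((2 * pi powr (real d / 2) / Gamma (real d / 2)) powr (1 / 2))"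
proof
  have dim: "DIM(real ^ 'n) = d"
    using assms(1) by simp
  show "((\<lambda>q::real. extension_const TYPE(real ^ 'n) (ennreal q))
      \<longlongrightarrow> extension_const TYPE(real ^ 'n) \<infinity>) at_top"
    by (rule extension_const_tendsto) (use dim assms(2) in auto)
  have area: "sphere_area TYPE(real ^ 'n) = 2 * pi powr (real d / 2) / Gamma (real d / 2)"
    unfolding sphere_area_eq dim ..
  show "extension_const TYPE(real ^ 'n) \<infinity>
      = ennreal ((2 * pi powr (real d / 2) / Gamma (real d / 2)) powr (1 / 2))"
    unfolding extension_const_infinity area[symmetric]
    using sphere_area_pos[where 'a="real ^ 'n"] by (simp add: powr_half_sqrt)
qed

end
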